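(* Let $2\le r\le s$ be integers. Then $i_{r+1}(T(s,r))$ is attained by $W[\frac1r,\ldots,\frac1r]$ (with $r$ parts).
   Context: All graphs are finite and simple. $T(s,r)$ is the Turán graph: the complete $r$-partite graph on $s$ vertices whose part sizes differ by at most one. For graphs $F,G$, $P(F,G)$ is the number of $|V(F)|$-subsets of $V(G)$ inducing a subgraph isomorphic to $F$, and $p(F,G)=P(F,G)/\binom{|V(G)|}{|V(F)|}$. $i_k(F,n)$ is the maximum of $p(F,G)$ over all $n$-vertex graphs $G$ not containing $K_k$ as a subgraph, and $i_k(F)=\lim_{n\to\infty}i_k(F,n)$ (the limit exists). For $x_1,\ldots,x_\ell>0$ with $\sum x_i=1$, the complete $\ell$-partite graphon $W[x_1,\ldots,x_\ell]:[0,1]^2\to\{0,1\}$ is obtained by partitioning $[0,1]$ into intervals of lengths $x_1,\ldots,x_\ell$ and setting $W(x,y)=1$ iff $x,y$ lie in distinct intervals. The induced density of $F$ in $W$ is the probability that $|V(F)|$ independent uniform points of $[0,1]$ induce a copy of $F$, where distinct $u,v$ are adjacent iff $W(u,v)=1$. $i_k(F)$ is attained by $W$ if the induced density of $F$ in $W$ equals $i_k(F)$. *)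

theory Defs
  imports "HOL-Probability.Probability"
begin

section \<open>Finite simple graphs\<close>

datatype 'a graph = Graph (verts: "'a set") (edges: "'a set set")

definition simple_graph :: "'a graph \<Rightarrow> bool" where
  "simple_graph G \<longleftrightarrow>
     finite (verts G) \<and> (\<forall>e\<in>edges G. e \<subseteq> verts G \<and> card e = 2)"

definition induced :: "'a graph \<Rightarrow> 'a set \<Rightarrow> 'a graph" where
  "induced G S = Graph S {e \<in> edges G. e \<subseteq> S}"

definition graph_iso :: "'a graph \<Rightarrow> 'b graph \<Rightarrow> bool" where
  "graph_iso G H \<longleftrightarrow>
     (\<exists>f. bij_betw f (verts G) (verts H) \<and>
          (\<forall>u\<in>verts G. \<forall>v\<in>verts G. {u, v} \<in> edges G \<longleftrightarrow> {f u, f v} \<in> edges H))"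

text \<open>Containment of a copy as a not necessarily induced subgraph.\<close>

definition contains_subgraph :: "'a graph \<Rightarrow> 'b graph \<Rightarrow> bool" where
  "contains_subgraph G H \<longleftrightarrow>
     (\<exists>f. inj_on f (verts H) \<and> f ` verts H \<subseteq> verts G \<and>
          (\<forall>u\<in>verts H. \<forall>v\<in>verts H. {u, v} \<in> edges H \<longrightarrow> {f u, f v} \<in> edges G))"

definition complete_graph :: "nat \<Rightarrow> nat graph" where
  "complete_graph k = Graph {..<k} {e. e \<subseteq> {..<k} \<and> card e = 2}"

text \<open>
  The function \<open>part\<close> sends a vertex to the index of its part. Being a Turan graph is
  a property of graphs on an arbitrary vertex type, so it describes an isomorphism class.
\<close>

definition turan_graph :: "nat \<Rightarrow> nat \<Rightarrow> 'a graph \<Rightarrow> bool" where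
  "turan_graph s r G \<longleftrightarrow>
     finite (verts G) \<and> card (verts G) = s \<and>
     (\<exists>part. part ` verts G \<subseteq> {..<r} \<and>
        edges G = {{u, v} | u v. u \<in> verts G \<and> v \<in> verts G \<and> part u \<noteq> part v} \<and>
        (\<forall>i<r. \<forall>j<r. card {v \<in> verts G. part v = i} \<le> card {v \<in> verts G. part v = j} + 1))"

section \<open>Induced densities in graphs\<close>

definition induced_count :: "'a graph \<Rightarrow> 'b graph \<Rightarrow> nat" where
  "induced_count F G =
     card {S. S \<subseteq> verts G \<and> card S = card (verts F) \<and> graph_iso (induced G S) F}"

definition induced_density :: "'a graph \<Rightarrow> 'b graph \<Rightarrow> real" where
  "induced_density F G =
     real (induced_count F G) / real (card (verts G) choose card (verts F))"

text \<open>Every finite graph is isomorphic to one whose vertices are natural numbers.\<close>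

definition free_graphs :: "nat \<Rightarrow> nat \<Rightarrow> nat graph set" where
  "free_graphs k n =
     {G. simple_graph G \<and> card (verts G) = n \<and> \<not> contains_subgraph G (complete_graph k)}"

definition max_induced_density :: "nat \<Rightarrow> 'a graph \<Rightarrow> nat \<Rightarrow> real" where
  "max_induced_density k F n = Max (induced_density F ` free_graphs k n)"

definition inducibility :: "nat \<Rightarrow> 'a graph \<Rightarrow> real" where
  "inducibility k F = lim (\<lambda>n. max_induced_density k F n)"

section \<open>Complete multipartite graphons\<close>

text \<open>
  Consecutive half-open intervals of lengths \<open>xs ! 0, xs ! 1, \<dots>\<close> starting at 0.
  The last one is closed, so that they partition the whole of \<open>{0..1}\<close> when the
  lengths are positive and sum to 1.
\<close>

definition graphon_part :: "real list \<Rightarrow> nat \<Rightarrow> real set" where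
  "graphon_part xs i =
     (if Suc i = length xs then {sum_list (take i xs)..sum_list (take (Suc i) xs)}
      else {sum_list (take i xs)..<sum_list (take (Suc i) xs)})"

definition multipartite_graphon :: "real list \<Rightarrow> real \<Rightarrow> real \<Rightarrow> real" where
  "multipartite_graphon xs x y =
     (if \<exists>i<length xs. x \<in> graphon_part xs i \<and> y \<in> graphon_part xs i then 0 else 1)"

text \<open>
  The graph sampled at the points \<open>x 0, \<dots>, x (m - 1)\<close>. Its vertices are the indices of the
  points; the points themselves are almost surely distinct.
\<close>

definition sampled_graph :: "(real \<Rightarrow> real \<Rightarrow> real) \<Rightarrow> nat \<Rightarrow> (nat \<Rightarrow> real) \<Rightarrow> nat graph" where
  "sampled_graph W m x =
     Graph {..<m} {{i, j} | i j. i < m \<and> j < m \<and> i \<noteq> j \<and> W (x i) (x j) = 1}"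

definition graphon_density :: "'a graph \<Rightarrow> (real \<Rightarrow> real \<Rightarrow> real) \<Rightarrow> real" where
  "graphon_density F W =
     (let m = card (verts F);
          M = PiM {..<m} (\<lambda>_. uniform_measure lborel {0..1})
      in measure M {x \<in> space M. graph_iso (sampled_graph W m x) F})"

definition attained_by :: "nat \<Rightarrow> 'a graph \<Rightarrow> (real \<Rightarrow> real \<Rightarrow> real) \<Rightarrow> bool" where
  "attained_by k F W \<longleftrightarrow> graphon_density F W = inducibility k F"

section \<open>Well-definedness\<close>

lemma turan_graph_simple: "turan_graph s r G \<Longrightarrow> simple_graph G"
  unfolding turan_graph_def simple_graph_def by (fastforce simp: card_2_iff)

lemma card_mod_class:
  fixes s r i :: nat
  assumes "i < r"
  shows "card {v \<in> {..<s}. v mod r = i} = s div r + (if i < s mod r then 1 else 0)"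
proof -
  have "{v \<in> {..<s}. v mod r = i} =
        (\<lambda>q. q * r + i) ` {..<s div r + (if i < s mod r then 1 else 0)}" (is "?L = ?R")
  proof (intro set_eqI iffI)
    fix v assume v: "v \<in> ?L"
    hence vm: "v mod r = i" and vs: "v < s" by auto
    have veq: "v = (v div r) * r + i" using vm by (metis div_mult_mod_eq)
    have "v div r \<le> s div r" using vs by (simp add: div_le_mono)
    moreover have "i < s mod r" if "v div r = s div r"
      using vs that veq by (metis div_mult_mod_eq nat_add_left_cancel_less)
    ultimately have "v div r < s div r + (if i < s mod r then 1 else 0)"
      by (cases "v div r = s div r") auto
    thus "v \<in> ?R" using veq by blast
  next
    fix v assume "v \<in> ?R"
    then obtain q where q: "v = q * r + i" "q < s div r + (if i < s mod r then 1 else 0)"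
      by auto
    have "v < s"
    proof (cases "q < s div r")
      case True
      hence "Suc q * r \<le> s div r * r" by (intro mult_le_mono1) auto
      also have "\<dots> \<le> s" by simp
      finally show ?thesis using q(1) assms by simp
    next
      case False
      hence "q = s div r" "i < s mod r" using q(2) by (auto split: if_splits)
      thus ?thesis using q(1) by (metis div_mult_mod_eq nat_add_left_cancel_less)
    qed
    thus "v \<in> ?L" using q(1) assms by simp
  qed
  moreover have "inj_on (\<lambda>q. q * r + i) {..<s div r + (if i < s mod r then 1 else 0)}"
    using assms by (auto simp: inj_on_def)
  ultimately show ?thesis by (simp add: card_image)
qed

lemma turan_graph_exists:
  assumes "r > 0"
  shows "turan_graph s r
           (Graph {..<s} {{u, v} | u v. u < s \<and> v < s \<and> u mod r \<noteq> v mod r})"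
  unfolding turan_graph_def
proof (intro conjI exI[of _ "\<lambda>v. v mod r"] allI impI)
  fix i j assume "i < r" "j < r"
  thus "card {v \<in> verts (Graph {..<s} {{u, v} | u v. u < s \<and> v < s \<and> u mod r \<noteq> v mod r}). v mod r = i}
        \<le> card {v \<in> verts (Graph {..<s} {{u, v} | u v. u < s \<and> v < s \<and> u mod r \<noteq> v mod r}). v mod r = j} + 1"
    unfolding graph.sel card_mod_class[OF \<open>i < r\<close>] card_mod_class[OF \<open>j < r\<close>] by simp
qed (use assms in auto)

lemma free_graphs_nonempty:
  assumes "k \<ge> 2"
  shows "free_graphs k n \<noteq> {}"
proof -
  have "{0, 1} \<in> edges (complete_graph k)" "0 \<in> verts (complete_graph k)"
       "1 \<in> verts (complete_graph k)"
    using assms by (auto simp: complete_graph_def)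
  hence "Graph {..<n} {} \<in> free_graphs k n"
    by (auto simp: free_graphs_def simple_graph_def contains_subgraph_def)
  thus ?thesis by blast
qed

lemma induced_count_le:
  assumes "simple_graph G"
  shows "induced_count F G \<le> card (verts G) choose card (verts F)"
proof -
  have fin: "finite (verts G)" using assms by (simp add: simple_graph_def)
  have "finite {S. S \<subseteq> verts G \<and> card S = card (verts F)}"
    by (rule finite_subset[of _ "Pow (verts G)"]) (use fin in blast, simp add: fin)
  hence "induced_count F G \<le> card {S. S \<subseteq> verts G \<and> card S = card (verts F)}"
    unfolding induced_count_def by (rule card_mono) blast
  thus ?thesis by (simp add: n_subsets fin)
qed

lemma finite_induced_densities: "finite (induced_density F ` free_graphs k n)"
proof (rule finite_subset)
  let ?b = "n choose card (verts F)"
  show "induced_density F ` free_graphs k n \<subseteq> (\<lambda>c. real c / real ?b) ` {..?b}"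
  proof
    fix d assume "d \<in> induced_density F ` free_graphs k n"
    then obtain G where G: "d = induced_density F G" and "G \<in> free_graphs k n" by blast
    hence sG: "simple_graph G" and cG: "card (verts G) = n" by (simp_all add: free_graphs_def)
    have "induced_count F G \<le> ?b" using induced_count_le[OF sG, of F] by (simp add: cG)
    moreover have "d = real (induced_count F G) / real ?b"
      by (simp add: G cG induced_density_def)
    ultimately show "d \<in> (\<lambda>c. real c / real ?b) ` {..?b}" by blast
  qed
qed simp

lemma induced_density_le_max:
  "G \<in> free_graphs k n \<Longrightarrow> induced_density F G \<le> max_induced_density k F n"
  unfolding max_induced_density_def by (rule Max_ge[OF finite_induced_densities]) auto

lemma max_induced_density_attained:
  assumes "k \<ge> 2"
  obtains G where "G \<in> free_graphs k n" "max_induced_density k F n = induced_density F G"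
proof -
  have "max_induced_density k F n \<in> induced_density F ` free_graphs k n"
    unfolding max_induced_density_def
    using free_graphs_nonempty[OF assms] by (intro Max_in finite_induced_densities) auto
  thus ?thesis using that by auto
qed

lemma induced_free_graphs:
  assumes "G \<in> free_graphs k (Suc n)" "v \<in> verts G"
  shows "induced G (verts G - {v}) \<in> free_graphs k n"
proof -
  let ?H = "induced G (verts G - {v})" and ?K = "complete_graph k"
  have sG: "simple_graph G" and cG: "card (verts G) = Suc n"
    and free: "\<not> contains_subgraph G ?K"
    using assms(1) by (simp_all add: free_graphs_def)
  have vH: "verts ?H = verts G - {v}" and eH: "edges ?H = {e \<in> edges G. e \<subseteq> verts G - {v}}"
    by (simp_all add: induced_def)
  have "simple_graph ?H"
    using sG unfolding simple_graph_def vH eH by simp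
  moreover have "card (verts ?H) = n"
    using sG cG assms(2) unfolding vH simple_graph_def by simp
  moreover have "\<not> contains_subgraph ?H ?K"
  proof
    assume "contains_subgraph ?H ?K"
    then obtain f where f: "inj_on f (verts ?K) \<and> f ` verts ?K \<subseteq> verts ?H \<and>
        (\<forall>u\<in>verts ?K. \<forall>w\<in>verts ?K. {u, w} \<in> edges ?K \<longrightarrow> {f u, f w} \<in> edges ?H)"
      unfolding contains_subgraph_def ..
    have "verts ?H \<subseteq> verts G" "edges ?H \<subseteq> edges G" unfolding vH eH by auto
    hence "contains_subgraph G ?K"
      unfolding contains_subgraph_def using f
      by (intro exI[of _ f] conjI ballI impI) (simp, meson order_trans, meson subsetD)
    thus False using free by contradiction
  qed
  ultimately show ?thesis by (simp add: free_graphs_def)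
qed

lemma max_induced_density_Suc_le:
  assumes k: "k \<ge> 2" and n: "card (verts F) \<le> n"
  shows "max_induced_density k F (Suc n) \<le> max_induced_density k F n"
proof -
  let ?m = "card (verts F)" and ?D = "max_induced_density k F n"
  obtain G where G: "G \<in> free_graphs k (Suc n)"
    and eq: "max_induced_density k F (Suc n) = induced_density F G"
    by (rule max_induced_density_attained[OF k])
  have fin: "finite (verts G)" and cG: "card (verts G) = Suc n"
    using G by (auto simp: free_graphs_def simple_graph_def)
  define C where "C = {S. S \<subseteq> verts G \<and> card S = ?m \<and> graph_iso (induced G S) F}"
  have finC: "finite C" using fin by (auto simp: C_def intro: finite_subset[of _ "Pow (verts G)"])
  have cnt: "induced_count F (induced G (verts G - {v})) = card {S \<in> C. v \<notin> S}" for v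
  proof -
    have ii: "induced (induced G (verts G - {v})) S = induced G S" if "S \<subseteq> verts G - {v}" for S
      using that by (auto simp: induced_def)
    have vi: "verts (induced G (verts G - {v})) = verts G - {v}"
      by (simp add: induced_def)
    have "(S \<subseteq> verts G - {v} \<and> card S = ?m \<and>
             graph_iso (induced (induced G (verts G - {v})) S) F) = (S \<in> C \<and> v \<notin> S)" for S
      by (cases "S \<subseteq> verts G - {v}") (simp add: C_def ii subset_Diff_insert, auto simp: C_def)
    thus ?thesis by (simp add: induced_count_def vi)
  qed
  have le: "real (card {S \<in> C. v \<notin> S}) \<le> ?D * real (n choose ?m)" if "v \<in> verts G" for v
  proof -
    have H: "induced G (verts G - {v}) \<in> free_graphs k n"
      by (rule induced_free_graphs[OF G that])
    have "real (card {S \<in> C. v \<notin> S}) / real (n choose ?m) \<le> ?D"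
      using induced_density_le_max[OF H, of F] H
      by (simp add: induced_density_def cnt free_graphs_def)
    thus ?thesis using n by (simp add: pos_divide_le_eq zero_less_binomial_iff)
  qed
  have "(\<Sum>v\<in>verts G. card {S \<in> C. v \<notin> S}) = (\<Sum>S\<in>C. card {v \<in> verts G. v \<notin> S})"
    using sum.swap_restrict[OF fin finC, of "\<lambda>_ _. 1::nat" "\<lambda>v S. v \<notin> S"]
    by simp
  also have "\<dots> = (\<Sum>S\<in>C. Suc n - ?m)"
  proof (rule sum.cong)
    fix S assume "S \<in> C"
    hence "S \<subseteq> verts G" "card S = ?m" by (auto simp: C_def)
    moreover have "{v \<in> verts G. v \<notin> S} = verts G - S" by auto
    ultimately show "card {v \<in> verts G. v \<notin> S} = Suc n - ?m"
      using fin cG by (simp add: card_Diff_subset finite_subset)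
  qed simp
  also have "\<dots> = card C * (Suc n - ?m)" by simp
  finally have "real (card C * (Suc n - ?m)) = real (\<Sum>v\<in>verts G. card {S \<in> C. v \<notin> S})"
    by (simp only:)
  also have "\<dots> = (\<Sum>v\<in>verts G. real (card {S \<in> C. v \<notin> S}))" by (rule of_nat_sum)
  also have "\<dots> \<le> (\<Sum>v\<in>verts G. ?D * real (n choose ?m))" by (rule sum_mono) (rule le)
  also have "\<dots> = ?D * real (Suc n * (n choose ?m))"
    by (simp only: sum_constant cG of_nat_mult mult_ac)
  also have "Suc n * (n choose ?m) = (Suc n - ?m) * (Suc n choose ?m)"
    using binomial_absorb_comp[of "Suc n" ?m] by simp
  finally have "real (card C) * real (Suc n - ?m) \<le> (?D * real (Suc n choose ?m)) * real (Suc n - ?m)"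
    by (simp add: mult_ac)
  hence "real (card C) \<le> ?D * real (Suc n choose ?m)"
    by (rule mult_right_le_imp_le) (use n in auto)
  hence "real (card C) / real (Suc n choose ?m) \<le> ?D"
    using n by (simp add: pos_divide_le_eq zero_less_binomial_iff)
  thus ?thesis by (simp add: eq induced_density_def induced_count_def C_def cG)
qed

lemma max_induced_density_convergent:
  assumes k: "k \<ge> 2"
  shows "convergent (\<lambda>n. max_induced_density k F n)"
proof -
  let ?m = "card (verts F)" and ?f = "\<lambda>n. max_induced_density k F (n + card (verts F))"
  have "decseq ?f"
    by (rule decseq_SucI) (use max_induced_density_Suc_le[OF k, of F] in auto)
  moreover have "0 \<le> ?f n" for n
    by (rule max_induced_density_attained[OF k, of "n + ?m" F]) (simp add: induced_density_def)
  ultimately obtain L where "?f \<longlonglongrightarrow> L" using decseq_convergent[of ?f 0] by blast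
  hence "(\<lambda>n. max_induced_density k F n) \<longlonglongrightarrow> L" by (rule LIMSEQ_offset)
  thus ?thesis by (auto simp: convergent_def)
qed

end

theory Submission
  imports Defs
begin

text \<open>
  Let \<open>F\<close> be a Turan graph with \<open>s\<close> vertices and \<open>r\<close> parts. Instead of vertex sets inducing
  \<open>F\<close>, count sequences of \<open>s\<close> vertices, repetitions allowed, whose adjacency pattern is
  isomorphic to \<open>F\<close>. For this count the extremal problem has an exact solution: if \<open>E\<close> has no
  clique on \<open>r + 1\<close> vertices, the count is at most \<open>D * (n / r) ^ s\<close>, where \<open>D\<close> is the number
  of colourings of the \<open>s\<close> indices with \<open>r\<close> colours whose complete multipartite graph is
  isomorphic to \<open>F\<close> (lemma \<open>pattern_count_clique_free_le\<close>). The number \<open>D / r ^ s\<close> is also the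
  density of \<open>F\<close> in the balanced \<open>r\<close>-partite graphon (lemma \<open>graphon_density_equal_parts\<close>).

  The bound has two ingredients. The first is Zykov symmetrization. Since non-adjacency is
  transitive in \<open>F\<close>, a copy of \<open>F\<close> that uses two non-adjacent vertices \<open>u\<close> and \<open>v\<close> survives when
  one of them is made a clone of the other. Hence the two possible clonings do not decrease the
  count on average (lemma \<open>cloning_average\<close>), and no larger clique arises. A maximal relation,
  with ties broken by the number of edgeless triples, is therefore complete multipartite
  (lemma \<open>symmetrization\<close>), with at most \<open>r\<close> parts.

  The second ingredient optimizes the part sizes \<open>a j\<close>. All parts of \<open>F\<close> have \<open>q\<close> or \<open>q + 1\<close>
  vertices and none is empty, so the count is a constant times \<open>(\<Prod>j. a j) ^ q\<close> times an
  elementary symmetric polynomial in the \<open>a j\<close>. By Maclaurin's inequality both factors are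
  largest when all \<open>a j\<close> are equal (lemma \<open>balanced_colourings_bound\<close>).

  Induced copies correspond to injective sequences up to the factor \<open>fact s\<close>, and all but a
  vanishing proportion of the sequences are injective. Therefore the bound gives
  \<open>inducibility (r + 1) F \<le> D / r ^ s\<close>, and the Turan graphs with \<open>r\<close> equal parts give equality
  (lemma \<open>inducibility_turan_graph\<close>).
\<close>

section \<open>Adjacency patterns of vertex sequences\<close>

definition adjacency_pattern :: "nat \<Rightarrow> ('v \<Rightarrow> 'v \<Rightarrow> bool) \<Rightarrow> (nat \<Rightarrow> 'v) \<Rightarrow> (nat \<times> nat) set" where
  "adjacency_pattern s E x = {(i, j). i < s \<and> j < s \<and> E (x i) (x j)}"

definition pattern_count ::
    "nat \<Rightarrow> ((nat \<times> nat) set \<Rightarrow> bool) \<Rightarrow> 'v set \<Rightarrow> ('v \<Rightarrow> 'v \<Rightarrow> bool) \<Rightarrow> nat" where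
  "pattern_count s \<Phi> V E = card {x \<in> {..<s} \<rightarrow>\<^sub>E V. \<Phi> (adjacency_pattern s E x)}"

definition forces_multipartite :: "nat \<Rightarrow> ((nat \<times> nat) set \<Rightarrow> bool) \<Rightarrow> bool" where
  "forces_multipartite s \<Phi> \<longleftrightarrow>
     (\<forall>A. \<Phi> A \<longrightarrow> sym A \<longrightarrow> irrefl A \<longrightarrow>
        (\<forall>i<s. \<forall>j<s. \<forall>k<s. (i, j) \<notin> A \<longrightarrow> (j, k) \<notin> A \<longrightarrow> (i, k) \<notin> A))"

text \<open>
  For irreflexive \<open>E\<close> the map \<open>f\<close> is automatically injective, so its image is a clique; a map
  can be composed directly with a vertex identification.
\<close>

definition clique_free :: "nat \<Rightarrow> 'v set \<Rightarrow> ('v \<Rightarrow> 'v \<Rightarrow> bool) \<Rightarrow> bool" where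
  "clique_free k V E \<longleftrightarrow>
     \<not> (\<exists>f. f ` {..<k} \<subseteq> V \<and> (\<forall>i<k. \<forall>j<k. i \<noteq> j \<longrightarrow> E (f i) (f j)))"

text \<open>
  Zykov's operation: \<open>u\<close> is replaced by a non-adjacent twin of \<open>v\<close>. Pulling the relation back
  along the identification of \<open>u\<close> with \<open>v\<close> makes the pattern of a sequence in the new graph
  the pattern of the identified sequence in the old one.
\<close>

definition clone :: "'v \<Rightarrow> 'v \<Rightarrow> ('v \<Rightarrow> 'v \<Rightarrow> bool) \<Rightarrow> 'v \<Rightarrow> 'v \<Rightarrow> bool" where
  "clone u v E = (\<lambda>x y. E ((id(u := v)) x) ((id(u := v)) y))"

lemma adjacency_pattern_cong:
  "(\<And>i. i < s \<Longrightarrow> x i = y i) \<Longrightarrow> adjacency_pattern s E x = adjacency_pattern s E y"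
  by (auto simp: adjacency_pattern_def)

lemma adjacency_pattern_clone:
  "adjacency_pattern s (clone u v E) x = adjacency_pattern s E (id(u := v) \<circ> x)"
  by (simp add: adjacency_pattern_def clone_def)

lemma sym_adjacency_pattern: "symp E \<Longrightarrow> sym (adjacency_pattern s E x)"
  unfolding adjacency_pattern_def sym_def symp_def by blast

lemma irrefl_adjacency_pattern: "irreflp E \<Longrightarrow> irrefl (adjacency_pattern s E x)"
  by (simp add: adjacency_pattern_def irrefl_def irreflp_def)

lemma symp_clone: "symp E \<Longrightarrow> symp (clone u v E)"
  unfolding clone_def symp_def by blast

lemma irreflp_clone: "irreflp E \<Longrightarrow> irreflp (clone u v E)"
  unfolding clone_def irreflp_def by blast

text \<open>
  A clique of the cloned graph never contains both \<open>u\<close> and \<open>v\<close>, and identifying the two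
  vertices carries it to a clique of the original graph.
\<close>

lemma clique_free_clone:
  assumes "clique_free k V E" "v \<in> V"
  shows "clique_free k V (clone u v E)"
  unfolding clique_free_def
proof
  assume "\<exists>f. f ` {..<k} \<subseteq> V \<and> (\<forall>i<k. \<forall>j<k. i \<noteq> j \<longrightarrow> clone u v E (f i) (f j))"
  then obtain f where f: "f ` {..<k} \<subseteq> V" "\<forall>i<k. \<forall>j<k. i \<noteq> j \<longrightarrow> clone u v E (f i) (f j)"
    by blast
  have "(id(u := v) \<circ> f) ` {..<k} \<subseteq> V" using f(1) assms(2) by auto
  moreover have "\<forall>i<k. \<forall>j<k. i \<noteq> j \<longrightarrow> E ((id(u := v) \<circ> f) i) ((id(u := v) \<circ> f) j)"
    using f(2) by (simp add: clone_def)
  ultimately show False using assms(1) unfolding clique_free_def by blast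
qed

lemma pattern_count_eq_sum:
  assumes "finite V"
  shows "pattern_count s \<Phi> V E = (\<Sum>x\<in>{..<s} \<rightarrow>\<^sub>E V. of_bool (\<Phi> (adjacency_pattern s E x)))"
  using assms by (simp add: pattern_count_def finite_PiE sum_of_bool_eq Int_def)

lemma pattern_count_le:
  assumes "finite V"
  shows "pattern_count s \<Phi> V E \<le> card V ^ s"
proof -
  have "pattern_count s \<Phi> V E \<le> card ({..<s} \<rightarrow>\<^sub>E V)"
    unfolding pattern_count_def using assms by (intro card_mono finite_PiE) auto
  thus ?thesis by (simp add: card_PiE)
qed

section \<open>Zykov symmetrization of pattern counts\<close>

text \<open>
  If a sequence with a multipartite pattern visits both of the non-adjacent vertices \<open>u\<close> and
  \<open>v\<close>, then both lie in one part, so they have the same neighbours among the visited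
  vertices and identifying them does not alter the pattern.
\<close>

lemma pattern_preserved_by_cloning:
  assumes mp: "forces_multipartite s \<Phi>" and E: "symp E" "irreflp E" "\<not> E u v"
    and uv: "u \<in> x ` {..<s}" "v \<in> x ` {..<s}"
    and \<Phi>: "\<Phi> (adjacency_pattern s E x)"
  shows "\<Phi> (adjacency_pattern s E (id(u := v) \<circ> x))"
proof -
  obtain i j where i: "i < s" "x i = u" and j: "j < s" "x j = v" using uv by auto
  have vu: "\<not> E v u" using E by (auto dest: sympD)
  let ?A = "adjacency_pattern s E x"
  have T: "(a, c) \<notin> ?A" if "(a, b) \<notin> ?A" "(b, c) \<notin> ?A" "a < s" "b < s" "c < s" for a b c
    using mp \<Phi> sym_adjacency_pattern[OF E(1)] irrefl_adjacency_pattern[OF E(2)] that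
    unfolding forces_multipartite_def by blast
  have twin: "E u (x k) = E v (x k)" if "k < s" for k
    using T[of i j k] T[of j i k] i j that E(3) vu by (auto simp: adjacency_pattern_def)
  hence twin': "E (x k) u = E (x k) v" if "k < s" for k
    using that E(1) by (meson sympE)
  have eq: "E ((id(u := v)) (x a)) ((id(u := v)) (x b)) = E (x a) (x b)" if "a < s" "b < s" for a b
    using twin[OF that(1)] twin[OF that(2)] twin'[OF that(1)] twin'[OF that(2)] E(2,3) vu
    by (auto simp: irreflp_def)
  have "adjacency_pattern s E (id(u := v) \<circ> x) = ?A"
    by (auto simp: adjacency_pattern_def eq simp del: fun_upd_apply)
  thus ?thesis using \<Phi> by simp
qed

text \<open>
  The swap \<open>\<tau>\<close> of \<open>u\<close> and \<open>v\<close> is the source of this comparison. On a sequence that misses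
  one of the two vertices, the two identifications act like the identity and like \<open>\<tau>\<close>, so
  both sides agree. On a sequence that visits both, a pattern that counts on the left survives
  both identifications.
\<close>

lemma cloning_pointwise:
  fixes u v :: 'v and x :: "nat \<Rightarrow> 'v"
  defines "\<tau> \<equiv> id(u := v, v := u)"
  assumes mp: "forces_multipartite s \<Phi>" and E: "symp E" "irreflp E" "\<not> E u v"
  shows "(of_bool (\<Phi> (adjacency_pattern s E x)) + of_bool (\<Phi> (adjacency_pattern s E (\<tau> \<circ> x))) :: nat)
    \<le> of_bool (\<Phi> (adjacency_pattern s (clone u v E) x)) + of_bool (\<Phi> (adjacency_pattern s (clone v u E) x))"
proof (cases "u \<in> x ` {..<s} \<and> v \<in> x ` {..<s}")
  case True
  have vu: "\<not> E v u" using E by (auto dest: sympD)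
  have \<tau>: "u \<in> (\<tau> \<circ> x) ` {..<s}" "v \<in> (\<tau> \<circ> x) ` {..<s}"
    using True by (force simp: \<tau>_def image_iff)+
  have eq: "adjacency_pattern s E (id(u := v) \<circ> (\<tau> \<circ> x)) = adjacency_pattern s E (id(u := v) \<circ> x)"
       "adjacency_pattern s E (id(v := u) \<circ> (\<tau> \<circ> x)) = adjacency_pattern s E (id(v := u) \<circ> x)"
    by (rule adjacency_pattern_cong, simp add: \<tau>_def)+
  note P = pattern_preserved_by_cloning[OF mp E(1,2)]
  have "\<Phi> (adjacency_pattern s E (id(u := v) \<circ> x)) \<and> \<Phi> (adjacency_pattern s E (id(v := u) \<circ> x))"
    if "\<Phi> (adjacency_pattern s E x) \<or> \<Phi> (adjacency_pattern s E (\<tau> \<circ> x))"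
    using that P[OF E(3), of x] P[OF vu, of x] P[OF E(3), of "\<tau> \<circ> x"] P[OF vu, of "\<tau> \<circ> x"] True \<tau> eq
    by auto
  thus ?thesis by (auto simp: adjacency_pattern_clone)
next
  case False
  have "adjacency_pattern s E (id(u := v) \<circ> x) = adjacency_pattern s E (\<tau> \<circ> x)
      \<and> adjacency_pattern s E (id(v := u) \<circ> x) = adjacency_pattern s E x
    \<or> adjacency_pattern s E (id(v := u) \<circ> x) = adjacency_pattern s E (\<tau> \<circ> x)
      \<and> adjacency_pattern s E (id(u := v) \<circ> x) = adjacency_pattern s E x"
  proof (cases "u \<in> x ` {..<s}")
    case True
    with False have "v \<notin> x ` {..<s}" by simp
    hence "adjacency_pattern s E (id(u := v) \<circ> x) = adjacency_pattern s E (\<tau> \<circ> x)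
      \<and> adjacency_pattern s E (id(v := u) \<circ> x) = adjacency_pattern s E x"
      by (intro conjI adjacency_pattern_cong) (auto simp: \<tau>_def)
    thus ?thesis ..
  next
    case False
    hence "adjacency_pattern s E (id(v := u) \<circ> x) = adjacency_pattern s E (\<tau> \<circ> x)
      \<and> adjacency_pattern s E (id(u := v) \<circ> x) = adjacency_pattern s E x"
      by (intro conjI adjacency_pattern_cong) (auto simp: \<tau>_def)
    thus ?thesis ..
  qed
  thus ?thesis by (auto simp: adjacency_pattern_clone)
qed

lemma pattern_count_swap:
  fixes u v :: 'v
  defines "\<tau> \<equiv> id(u := v, v := u)"
  assumes "finite V" "u \<in> V" "v \<in> V"
  shows "(\<Sum>x\<in>{..<s} \<rightarrow>\<^sub>E V. of_bool (\<Phi> (adjacency_pattern s E (\<tau> \<circ> x)))) = pattern_count s \<Phi> V E"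
proof -
  have \<tau>\<tau>: "\<tau> (\<tau> y) = y" for y by (simp add: \<tau>_def)
  have \<tau>V: "\<tau> y \<in> V" if "y \<in> V" for y using that assms by (simp add: \<tau>_def)
  let ?h = "\<lambda>x. restrict (\<tau> \<circ> x) {..<s}"
  have hh: "?h (?h x) = x" if "x \<in> {..<s} \<rightarrow>\<^sub>E V" for x
    using that \<tau>\<tau> by (auto simp: fun_eq_iff restrict_def PiE_def extensional_def)
  have hV: "?h x \<in> {..<s} \<rightarrow>\<^sub>E V" if "x \<in> {..<s} \<rightarrow>\<^sub>E V" for x
    using that \<tau>V by (auto simp: PiE_def Pi_def)
  have "bij_betw ?h ({..<s} \<rightarrow>\<^sub>E V) ({..<s} \<rightarrow>\<^sub>E V)"
    by (rule bij_betw_byWitness[where f' = ?h]) (use hh hV in blast)+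
  hence "(\<Sum>x\<in>{..<s} \<rightarrow>\<^sub>E V. of_bool (\<Phi> (adjacency_pattern s E (?h x))))
      = (\<Sum>x\<in>{..<s} \<rightarrow>\<^sub>E V. of_bool (\<Phi> (adjacency_pattern s E x)) :: nat)"
    by (rule sum.reindex_bij_betw)
  moreover have "adjacency_pattern s E (?h x) = adjacency_pattern s E (\<tau> \<circ> x)" for x
    by (rule adjacency_pattern_cong) simp
  ultimately show ?thesis by (simp add: pattern_count_eq_sum[OF assms(2)])
qed

text \<open>
  Summing the pointwise comparison over all sequences, where \<open>\<tau>\<close> only permutes the summands:
  the two ways of cloning on average do not decrease the count.
\<close>

lemma
  fixes u v :: 'v
  assumes mp: "forces_multipartite s \<Phi>" and E: "symp E" "irreflp E" "\<not> E u v"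
    and V: "finite V" "u \<in> V" "v \<in> V"
  shows cloning_average:
      "2 * pattern_count s \<Phi> V E \<le> pattern_count s \<Phi> V (clone u v E) + pattern_count s \<Phi> V (clone v u E)"
    and cloning_average_strict:
      "\<lbrakk>y \<in> {..<s} \<rightarrow>\<^sub>E V; \<not> \<Phi> (adjacency_pattern s E y);
        \<not> \<Phi> (adjacency_pattern s E (id(u := v, v := u) \<circ> y));
        \<Phi> (adjacency_pattern s (clone v u E) y)\<rbrakk> \<Longrightarrow>
       2 * pattern_count s \<Phi> V E < pattern_count s \<Phi> V (clone u v E) + pattern_count s \<Phi> V (clone v u E)"
proof -
  let ?X = "{..<s} \<rightarrow>\<^sub>E V"
  let ?l = "\<lambda>x. of_bool (\<Phi> (adjacency_pattern s E x))
              + of_bool (\<Phi> (adjacency_pattern s E (id(u := v, v := u) \<circ> x))) :: nat"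
  let ?r = "\<lambda>x. of_bool (\<Phi> (adjacency_pattern s (clone u v E) x))
              + of_bool (\<Phi> (adjacency_pattern s (clone v u E) x)) :: nat"
  have l: "sum ?l ?X = 2 * pattern_count s \<Phi> V E"
    using pattern_count_swap[OF V, of \<Phi> s E]
    by (simp only: sum.distrib pattern_count_eq_sum[OF V(1), symmetric] mult_2)
  have r: "sum ?r ?X = pattern_count s \<Phi> V (clone u v E) + pattern_count s \<Phi> V (clone v u E)"
    by (simp only: sum.distrib pattern_count_eq_sum[OF V(1), symmetric])
  have le: "?l x \<le> ?r x" for x
    by (rule cloning_pointwise[OF mp E])
  show "2 * pattern_count s \<Phi> V E \<le> pattern_count s \<Phi> V (clone u v E) + pattern_count s \<Phi> V (clone v u E)"
    unfolding l[symmetric] r[symmetric] by (rule sum_mono) (rule le)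
  show "2 * pattern_count s \<Phi> V E < pattern_count s \<Phi> V (clone u v E) + pattern_count s \<Phi> V (clone v u E)"
    if "y \<in> ?X" "\<not> \<Phi> (adjacency_pattern s E y)"
      "\<not> \<Phi> (adjacency_pattern s E (id(u := v, v := u) \<circ> y))"
      "\<Phi> (adjacency_pattern s (clone v u E) y)"
    unfolding l[symmetric] r[symmetric]
  proof (rule sum_strict_mono_ex1)
    show "finite ?X" using V(1) by (simp add: finite_PiE)
    show "\<forall>x\<in>?X. ?l x \<le> ?r x" using le by blast
    show "\<exists>x\<in>?X. ?l x < ?r x" using that by (intro bexI[of _ y]) auto
  qed
qed

text \<open>
  Averaging alone allows ties. Ties are broken by the number of ordered triples spanning no
  edge: if non-adjacency fails to be transitive at \<open>u, v, w\<close>, the triple \<open>(u, v, w)\<close> spans no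
  edge once \<open>v\<close> is a clone of \<open>u\<close>, whereas before both it and its image under the swap contained
  the edge between \<open>v\<close> and \<open>w\<close>.
\<close>

lemma independent_triples_increase:
  fixes u v w :: 'v
  assumes E: "symp E" "irreflp E" and V: "finite V" "u \<in> V" "v \<in> V" "w \<in> V"
    and uv: "\<not> E u v" and uw: "\<not> E u w" and vw: "E v w"
  shows "2 * pattern_count 3 (\<lambda>A. A = {}) V E
    < pattern_count 3 (\<lambda>A. A = {}) V (clone u v E) + pattern_count 3 (\<lambda>A. A = {}) V (clone v u E)"
proof -
  define y where "y = (\<lambda>i\<in>{..<3::nat}. if i = 0 then u else if i = 1 then v else w)"
  have y: "y 0 = u" "y (Suc 0) = v" "y 2 = w" by (simp_all add: y_def)
  have wne: "w \<noteq> u" "w \<noteq> v" using vw uv E by (auto simp: irreflp_def symp_def)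
  have "forces_multipartite 3 (\<lambda>A. A = {})" by (simp add: forces_multipartite_def)
  moreover have "y \<in> {..<3} \<rightarrow>\<^sub>E V" using V by (auto simp: y_def)
  moreover have "(1, 2) \<in> adjacency_pattern 3 E y"
    using vw by (simp add: adjacency_pattern_def y)
  moreover have "(0, 2) \<in> adjacency_pattern 3 E (id(u := v, v := u) \<circ> y)"
    using vw wne by (auto simp: adjacency_pattern_def y)
  moreover have "adjacency_pattern 3 (clone v u E) y = {}"
  proof -
    have "\<not> E w u" using uw E(1) by (auto dest: sympD)
    hence "\<not> E ((id(v := u)) (y i)) ((id(v := u)) (y j))" if "i < 3" "j < 3" for i j
      using that wne uw E(2) by (auto simp: y_def irreflp_def)
    thus ?thesis by (auto simp: adjacency_pattern_def clone_def)
  qed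
  ultimately show ?thesis using E V uv by (intro cloning_average_strict[where y = y]) auto
qed

text \<open>
  A relation maximizing the pattern count, and among those the number of edgeless triples,
  is complete multipartite, because otherwise one of the two clonings at a failure of
  transitivity would improve it.
\<close>

lemma symmetrization:
  fixes V :: "'v set"
  assumes mp: "forces_multipartite s \<Phi>" and V: "finite V"
    and E: "symp E" "irreflp E" "clique_free k V E"
  obtains E' where "symp E'" "irreflp E'" "clique_free k V E'"
    "pattern_count s \<Phi> V E \<le> pattern_count s \<Phi> V E'"
    "\<And>u v w. \<lbrakk>u \<in> V; v \<in> V; w \<in> V; \<not> E' u v; \<not> E' v w\<rbrakk> \<Longrightarrow> \<not> E' u w"
proof -
  define H where "H E = pattern_count s \<Phi> V E" for E
  define I where "I E = pattern_count 3 (\<lambda>A. A = {}) V E" for E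
  \<comment> \<open>There are at most \<open>card V ^ 3\<close> triples, so \<open>\<Psi>\<close> orders pairs \<open>(H, I)\<close> lexicographically.\<close>
  define M where "M = Suc (card V ^ 3)"
  define \<Psi> where "\<Psi> E = M * H E + I E" for E
  let ?P = "\<lambda>E. symp E \<and> irreflp E \<and> clique_free k V E"
  have I_less: "I E < M" for E
    using pattern_count_le[OF V, of 3] by (simp add: I_def M_def less_Suc_eq_le)
  have \<Psi>_less: "\<Psi> E \<le> M * card V ^ s + M" for E
    unfolding \<Psi>_def H_def
    by (intro add_mono mult_left_mono pattern_count_le[OF V] less_imp_le[OF I_less]) simp
  have "\<exists>E'. ?P E' \<and> (\<forall>E''. ?P E'' \<longrightarrow> \<Psi> E'' \<le> \<Psi> E')"
    by (rule Lattices_Big.ex_has_greatest_nat[where k = E and b = "Suc (M * card V ^ s + M)"])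
      (use E \<Psi>_less in \<open>simp_all add: less_Suc_eq_le\<close>)
  then obtain E' where E': "?P E'" and max: "\<And>E''. ?P E'' \<Longrightarrow> \<Psi> E'' \<le> \<Psi> E'"
    by blast
  have HE: "H E \<le> H E'"
  proof (rule ccontr)
    assume "\<not> H E \<le> H E'"
    hence "M * Suc (H E') \<le> M * H E" by (intro mult_left_mono) auto
    hence "\<Psi> E' < \<Psi> E" using I_less[of E'] by (simp add: \<Psi>_def)
    thus False using max[of E] E by simp
  qed
  have trans: "\<not> E' u w" if V': "u \<in> V" "v \<in> V" "w \<in> V" and n: "\<not> E' u v" "\<not> E' v w" for u v w
  proof
    assume uw: "E' u w"
    have vu: "\<not> E' v u" using E' n by (auto dest: sympD)
    have "2 * H E' \<le> H (clone v u E') + H (clone u v E')"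
      unfolding H_def using E' vu V V' mp by (intro cloning_average) auto
    hence "2 * (M * H E') \<le> M * H (clone v u E') + M * H (clone u v E')"
      by (metis add_mult_distrib2 mult.left_commute mult_le_mono2)
    moreover have "2 * I E' < I (clone v u E') + I (clone u v E')"
      unfolding I_def using E' vu V V' n uw by (intro independent_triples_increase) auto
    ultimately have "2 * \<Psi> E' < \<Psi> (clone v u E') + \<Psi> (clone u v E')"
      by (simp add: \<Psi>_def)
    moreover have "\<Psi> (clone v u E') \<le> \<Psi> E'" "\<Psi> (clone u v E') \<le> \<Psi> E'"
      using E' V' by (auto intro!: max symp_clone irreflp_clone clique_free_clone)
    ultimately show False by simp
  qed
  show ?thesis
    by (rule that[of E']) (use E' HE trans in \<open>unfold H_def, blast+\<close>)
qed

section \<open>Pattern counts of complete multipartite graphs\<close>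

definition good_colourings :: "nat \<Rightarrow> nat \<Rightarrow> ((nat \<times> nat) set \<Rightarrow> bool) \<Rightarrow> (nat \<Rightarrow> nat) set" where
  "good_colourings s r \<Phi> = {d \<in> {..<s} \<rightarrow>\<^sub>E {..<r}. \<Phi> (adjacency_pattern s (\<noteq>) d)}"

text \<open>
  The non-neighbourhoods are the classes of the equivalence relation given by non-adjacency.
  Representatives of distinct classes are adjacent, so there are at most \<open>r\<close> classes.
\<close>

lemma multipartite_colouring:
  fixes V :: "'v set"
  assumes V: "finite V" and E: "symp E" "irreflp E" and free: "clique_free (Suc r) V E"
    and trans: "\<And>u v w. \<lbrakk>u \<in> V; v \<in> V; w \<in> V; \<not> E u v; \<not> E v w\<rbrakk> \<Longrightarrow> \<not> E u w"
  obtains c where "c ` V \<subseteq> {..<r}" "\<And>x y. \<lbrakk>x \<in> V; y \<in> V\<rbrakk> \<Longrightarrow> E x y \<longleftrightarrow> c x \<noteq> c y"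
proof -
  define N where "N x = {y \<in> V. \<not> E x y}" for x
  have N: "N x = N y \<longleftrightarrow> \<not> E x y" if "x \<in> V" "y \<in> V" for x y
  proof
    assume "N x = N y"
    moreover have "y \<in> N y" using that E(2) by (simp add: N_def irreflp_def)
    ultimately show "\<not> E x y" by (auto simp: N_def)
  next
    assume xy: "\<not> E x y"
    hence yx: "\<not> E y x" using E(1) by (auto dest: sympD)
    show "N x = N y"
      unfolding N_def using trans[OF that(1,2) _ xy] trans[OF that(2,1) _ yx] that
      using trans xy yx by blast
  qed
  have "card (N ` V) \<le> r"
  proof (rule ccontr)
    assume "\<not> card (N ` V) \<le> r"
    then obtain Q where Q: "Q \<subseteq> N ` V" "card Q = Suc r" "finite Q"
      by (metis not_less_eq_eq obtain_subset_with_card_n)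
    obtain g where g: "bij_betw g {..<Suc r} Q"
      using ex_bij_betw_nat_finite[OF Q(3)] Q(2) by (auto simp: atLeast0LessThan)
    define f where "f i = inv_into V N (g i)" for i
    have gQ: "g i \<in> N ` V" if "i < Suc r" for i using g Q(1) that by (auto simp: bij_betw_def)
    have fV: "f i \<in> V" and Nf: "N (f i) = g i" if "i < Suc r" for i
      using gQ[OF that] by (simp_all add: f_def inv_into_into f_inv_into_f)
    have "E (f i) (f j)" if "i < Suc r" "j < Suc r" "i \<noteq> j" for i j
    proof -
      have "g i \<noteq> g j" using g that by (auto simp: bij_betw_def inj_on_def)
      thus ?thesis using N[OF fV fV] Nf that by metis
    qed
    moreover have "f ` {..<Suc r} \<subseteq> V" using fV by blast
    ultimately show False using free unfolding clique_free_def by blast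
  qed
  then obtain h where h: "inj_on h (N ` V)" "h ` (N ` V) \<subseteq> {..<r}"
    using inj_on_iff_card_le[of "N ` V" "{..<r}"] V by auto
  show ?thesis
  proof (rule that[of "h \<circ> N"])
    show "(h \<circ> N) ` V \<subseteq> {..<r}" using h(2) by (simp add: image_comp)
    show "E x y \<longleftrightarrow> (h \<circ> N) x \<noteq> (h \<circ> N) y" if "x \<in> V" "y \<in> V" for x y
      using N[OF that] inj_on_eq_iff[OF h(1), of "N x" "N y"] that by simp
  qed
qed

text \<open>
  The pattern of a sequence in a complete multipartite graph depends only on the parts it
  visits, so the sequences are grouped by the colouring of the indices that they induce.
\<close>

lemma pattern_count_multipartite:
  assumes V: "finite V" and c: "c ` V \<subseteq> {..<r}"
    and E: "\<And>x y. \<lbrakk>x \<in> V; y \<in> V\<rbrakk> \<Longrightarrow> E x y \<longleftrightarrow> c x \<noteq> c y"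
  shows "pattern_count s \<Phi> V E = (\<Sum>d\<in>good_colourings s r \<Phi>. \<Prod>i<s. card {v \<in> V. c v = d i})"
proof -
  let ?B = "\<lambda>d. \<Pi>\<^sub>E i\<in>{..<s}. {v \<in> V. c v = d i}"
  have pat: "adjacency_pattern s E x = adjacency_pattern s (\<noteq>) d" if "x \<in> ?B d" for x d
  proof -
    have "x i \<in> V" "c (x i) = d i" if "i < s" for i using \<open>x \<in> ?B d\<close> that by auto
    thus ?thesis using E by (auto simp: adjacency_pattern_def)
  qed
  have "{x \<in> {..<s} \<rightarrow>\<^sub>E V. \<Phi> (adjacency_pattern s E x)} = (\<Union>d\<in>good_colourings s r \<Phi>. ?B d)"
  proof (intro equalityI subsetI)
    fix x assume x: "x \<in> {x \<in> {..<s} \<rightarrow>\<^sub>E V. \<Phi> (adjacency_pattern s E x)}"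
    define d where "d = restrict (c \<circ> x) {..<s}"
    have xB: "x \<in> ?B d" using x by (auto simp: d_def PiE_def Pi_def)
    moreover have "d \<in> {..<s} \<rightarrow>\<^sub>E {..<r}" using x c by (auto simp: d_def PiE_def Pi_def)
    ultimately have "d \<in> good_colourings s r \<Phi>" using x pat[OF xB] by (simp add: good_colourings_def)
    thus "x \<in> (\<Union>d\<in>good_colourings s r \<Phi>. ?B d)" using xB by blast
  next
    fix x assume "x \<in> (\<Union>d\<in>good_colourings s r \<Phi>. ?B d)"
    then obtain d where d: "d \<in> good_colourings s r \<Phi>" "x \<in> ?B d" by blast
    have "x \<in> {..<s} \<rightarrow>\<^sub>E V" using d(2) by (auto simp: PiE_def Pi_def)
    thus "x \<in> {x \<in> {..<s} \<rightarrow>\<^sub>E V. \<Phi> (adjacency_pattern s E x)}"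
      using d pat[OF d(2)] by (simp add: good_colourings_def)
  qed
  moreover have "card (\<Union>d\<in>good_colourings s r \<Phi>. ?B d) = (\<Sum>d\<in>good_colourings s r \<Phi>. card (?B d))"
  proof (rule card_UN_disjoint)
    show "finite (good_colourings s r \<Phi>)" unfolding good_colourings_def by (simp add: finite_PiE)
    show "\<forall>d\<in>good_colourings s r \<Phi>. finite (?B d)" using V by (simp add: finite_PiE)
    have "d = d'" if "d \<in> good_colourings s r \<Phi>" "d' \<in> good_colourings s r \<Phi>" "x \<in> ?B d" "x \<in> ?B d'"
      for d d' x
    proof (rule PiE_ext[of _ "{..<s}" "\<lambda>_. {..<r}"])
      show "d \<in> {..<s} \<rightarrow>\<^sub>E {..<r}" "d' \<in> {..<s} \<rightarrow>\<^sub>E {..<r}"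
        using that by (simp_all add: good_colourings_def)
      fix i assume i: "i \<in> {..<s}"
      have "c (x i) = d i" "c (x i) = d' i" using that(3,4) i by auto
      thus "d i = d' i" by simp
    qed
    thus "\<forall>d\<in>good_colourings s r \<Phi>. \<forall>d'\<in>good_colourings s r \<Phi>. d \<noteq> d' \<longrightarrow> ?B d \<inter> ?B d' = {}"
      by blast
  qed
  ultimately show ?thesis by (simp add: pattern_count_def card_PiE)
qed

section \<open>Maclaurin's inequality\<close>

text \<open>
  With \<open>y = (a - m) / (k + 1)\<close>, the change of the mean when \<open>a\<close> joins \<open>k\<close> numbers of mean \<open>m\<close>,
  and after division by the binomial coefficient on the right, this is Bernoulli's inequality
  \<open>m ^ (t + 1) + (t + 1) * y * m ^ t \<le> (m + y) ^ (t + 1)\<close>.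
\<close>

lemma maclaurin_step:
  fixes m a :: real
  assumes m: "m \<ge> 0" and a: "a \<ge> 0"
  shows "real (k choose Suc t) * m ^ Suc t + a * (real (k choose t) * m ^ t)
    \<le> real (Suc k choose Suc t) * ((real k * m + a) / real (Suc k)) ^ Suc t"
proof -
  let ?C = "real (Suc k choose Suc t)"
  have absorb: "real (k choose t) = ?C * (real (Suc t) / real (Suc k))"
    using Suc_times_binomial_eq[of k t] by (simp add: field_simps flip: of_nat_mult of_nat_Suc)
  have pascal: "real (k choose Suc t) = ?C - real (k choose t)"
    by simp
  define y where "y = (a - m) / real (Suc k)"
  have M: "(real k * m + a) / real (Suc k) = m + y"
    by (simp add: y_def field_simps)
  have "m ^ Suc t + real (Suc t) * y * m ^ t \<le> (m + y) ^ Suc t"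
  proof (cases "m = 0")
    case True
    thus ?thesis using a by (cases t) (auto simp: y_def)
  next
    case False
    hence m0: "m > 0" using m by simp
    have "m * -1 \<le> y" using a mult_nonneg_nonneg[OF m, of "real k"] by (simp add: y_def field_simps)
    hence "-1 \<le> y / m" using m0 by (simp add: field_simps)
    hence "1 + real (Suc t) * (y / m) \<le> (1 + y / m) ^ Suc t"
      by (rule Bernoulli_inequality)
    hence "m ^ Suc t * (1 + real (Suc t) * (y / m)) \<le> m ^ Suc t * (1 + y / m) ^ Suc t"
      using m0 by (intro mult_left_mono) auto
    also have "\<dots> = (m * (1 + y / m)) ^ Suc t" by (simp only: power_mult_distrib)
    also have "m * (1 + y / m) = m + y" using m0 by (simp add: field_simps)
    also have "m ^ Suc t * (1 + real (Suc t) * (y / m)) = m ^ Suc t + real (Suc t) * y * m ^ t"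
      using m0 by (simp add: field_simps)
    finally show ?thesis .
  qed
  hence "?C * (m ^ Suc t + real (Suc t) * y * m ^ t) \<le> ?C * (m + y) ^ Suc t"
    by (rule mult_left_mono) simp
  moreover have "real (k choose Suc t) * m ^ Suc t + a * (real (k choose t) * m ^ t)
      = ?C * (m ^ Suc t + real (Suc t) * y * m ^ t)"
  proof -
    have "(C - C * (T / K)) * (m * X) + a * (C * (T / K) * X) = C * (m * X + T * ((a - m) / K) * X)"
      if "K \<noteq> 0" for C T K X :: real
      using that by (simp add: field_simps)
    from this[of "real (Suc k)" ?C "real (Suc t)" "m ^ t"] show ?thesis
      unfolding pascal absorb y_def power_Suc by (simp del: binomial_Suc_Suc of_nat_Suc)
  qed
  ultimately show ?thesis by (simp only: M)
qed

text \<open>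
  The elementary symmetric polynomials split according to whether the newest element is chosen,
  which reduces each induction step to the inequality above. For \<open>t = card A\<close> this is the
  inequality between the arithmetic and the geometric mean.
\<close>

lemma maclaurin_inequality:
  fixes a :: "'b \<Rightarrow> real"
  assumes "finite A" "\<And>x. x \<in> A \<Longrightarrow> 0 \<le> a x"
  shows "(\<Sum>J | J \<subseteq> A \<and> card J = t. \<Prod>x\<in>J. a x)
    \<le> real (card A choose t) * (sum a A / real (card A)) ^ t"
  using assms
proof (induction A arbitrary: t rule: finite_induct)
  case empty
  show ?case
  proof (cases t)
    case 0
    have "{J. J \<subseteq> {} \<and> card J = 0} = {{} :: 'b set}" by auto
    thus ?thesis by (simp add: 0)
  next
    case (Suc t')
    have "{J. J \<subseteq> {} \<and> card J = Suc t'} = ({} :: 'b set set)" by auto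
    thus ?thesis by (simp add: Suc)
  qed
next
  case (insert z A)
  show ?case
  proof (cases t)
    case 0
    have "{J. J \<subseteq> insert z A \<and> card J = 0} = {{}}"
      using insert.hyps by (auto dest: finite_subset)
    thus ?thesis by (simp add: 0)
  next
    case (Suc t')
    let ?P = "\<lambda>B k. {J. J \<subseteq> B \<and> card J = k}"
    let ?m = "sum a A / real (card A)"
    have fin: "finite (?P B k)" if "finite B" for B :: "'b set" and k
      using that by simp
    have nz: "J \<in> ?P A k \<Longrightarrow> z \<notin> J \<and> finite J" for J k
      using insert.hyps by (auto dest: finite_subset)
    have split: "?P (insert z A) (Suc t') = ?P A (Suc t') \<union> insert z ` ?P A t'"
    proof (intro equalityI subsetI)
      fix J assume J: "J \<in> ?P (insert z A) (Suc t')"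
      hence "finite J" using insert.hyps(1) by (auto dest: finite_subset)
      show "J \<in> ?P A (Suc t') \<union> insert z ` ?P A t'"
      proof (cases "z \<in> J")
        case True
        hence "J - {z} \<in> ?P A t'" "J = insert z (J - {z})" using J \<open>finite J\<close> by auto
        thus ?thesis by blast
      qed (use J in auto)
    next
      fix J assume "J \<in> ?P A (Suc t') \<union> insert z ` ?P A t'"
      then consider "J \<in> ?P A (Suc t')" | K where "K \<in> ?P A t'" "J = insert z K" by blast
      thus "J \<in> ?P (insert z A) (Suc t')"
      proof cases
        case 2
        thus ?thesis using nz[OF 2(1)] by (simp add: subset_insertI2)
      qed auto
    qed
    have disj: "?P A (Suc t') \<inter> insert z ` ?P A t' = {}" using insert.hyps(2) by blast
    have "(\<Sum>J\<in>?P (insert z A) (Suc t'). prod a J)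
        = (\<Sum>J\<in>?P A (Suc t'). prod a J) + (\<Sum>J\<in>insert z ` ?P A t'. prod a J)"
      unfolding split using insert.hyps(1) by (intro sum.union_disjoint disj) simp_all
    also have "(\<Sum>J\<in>insert z ` ?P A t'. prod a J) = (\<Sum>J\<in>?P A t'. prod a (insert z J))"
    proof (rule sum.reindex_cong[of "insert z"])
      show "inj_on (insert z) (?P A t')" unfolding inj_on_def using nz by (metis insert_ident)
    qed auto
    also have "\<dots> = (\<Sum>J\<in>?P A t'. a z * prod a J)"
      by (intro sum.cong refl prod.insert) (use nz in blast)+
    also have "\<dots> = a z * (\<Sum>J\<in>?P A t'. prod a J)" by (simp only: sum_distrib_left)
    also have "(\<Sum>J\<in>?P A (Suc t'). prod a J) + a z * (\<Sum>J\<in>?P A t'. prod a J)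
        \<le> real (card A choose Suc t') * ?m ^ Suc t' + a z * (real (card A choose t') * ?m ^ t')"
      using insert.prems by (intro add_mono mult_left_mono insert.IH) auto
    also have "\<dots> \<le> real (Suc (card A) choose Suc t') *
        ((real (card A) * ?m + a z) / real (Suc (card A))) ^ Suc t'"
      using insert.prems by (intro maclaurin_step divide_nonneg_nonneg sum_nonneg) auto
    also have "real (card A) * ?m = sum a A"
      using insert.hyps(1) by (cases "A = {}") auto
    finally show ?thesis
      using insert.hyps by (simp add: Suc add.commute)
  qed
qed

section \<open>Weight of balanced colourings\<close>

lemma ex_bij_betw_mapping_subset:
  assumes "finite A" "K \<subseteq> A" "K' \<subseteq> A" "card K = card K'"
  obtains \<pi> where "bij_betw \<pi> A A" "\<pi> ` K = K'"
proof -
  have fin: "finite K" "finite K'" using assms finite_subset by blast+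
  have "card (A - K) = card (A - K')" using assms fin by (simp add: card_Diff_subset)
  then obtain f g where f: "bij_betw f K K'" and g: "bij_betw g (A - K) (A - K')"
    using finite_same_card_bij[OF fin assms(4)] finite_same_card_bij[of "A - K" "A - K'"] assms(1)
    by auto
  let ?\<pi> = "\<lambda>x. if x \<in> K then f x else g x"
  have "bij_betw ?\<pi> (K \<union> (A - K)) (K' \<union> (A - K'))"
    by (rule bij_betw_disjoint_Un[OF f g]) auto
  moreover have "K \<union> (A - K) = A" "K' \<union> (A - K') = A" using assms by auto
  moreover have "?\<pi> ` K = K'" using f by (auto simp: bij_betw_def)
  ultimately show ?thesis using that by simp
qed

text \<open>
  A balanced colouring \<open>d\<close> has weight \<open>(\<Prod>j<r. a j) ^ q * prod a (J d)\<close>, where \<open>J d\<close> is its set of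
  large classes; all these sets have the same size \<open>t\<close>. Permuting colours shows that each set
  of size \<open>t\<close> arises equally often, so the total weight is a multiple of
  \<open>(\<Prod>j<r. a j) ^ q\<close> times the elementary symmetric polynomial of degree \<open>t\<close>, and Maclaurin's
  inequality bounds both factors by their values at equal \<open>a j\<close>.
\<close>

lemma balanced_colourings_bound:
  fixes a :: "nat \<Rightarrow> real" and D :: "(nat \<Rightarrow> nat) set"
  assumes D: "D \<subseteq> {..<s} \<rightarrow>\<^sub>E {..<r}"
    and balanced: "\<And>d j. d \<in> D \<Longrightarrow> j < r \<Longrightarrow> card {i. i < s \<and> d i = j} \<in> {q, Suc q}"
    and perm: "\<And>d \<pi>. d \<in> D \<Longrightarrow> bij_betw \<pi> {..<r} {..<r} \<Longrightarrow> restrict (\<pi> \<circ> d) {..<s} \<in> D"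
    and a: "\<And>j. j < r \<Longrightarrow> 0 \<le> a j"
  shows "(\<Sum>d\<in>D. \<Prod>i<s. a (d i)) \<le> real (card D) * ((\<Sum>j<r. a j) / real r) ^ s"
proof -
  define J where "J d = {j. j < r \<and> card {i. i < s \<and> d i = j} = Suc q}" for d
  define t where "t = s - r * q"
  define T where "T = {K. K \<subseteq> {..<r} \<and> card K = t}"
  define N where "N K = card {d \<in> D. J d = K}" for K
  define \<mu> where "\<mu> = (\<Sum>j<r. a j) / real r"
  define p where "p = (\<Prod>j<r. a j)"
  have finD: "finite D" using D by (rule finite_subset) (simp add: finite_PiE)
  have finT: "finite T" unfolding T_def by simp
  have class_size: "card {i. i < s \<and> d i = j} = q + of_bool (j \<in> J d)" if "d \<in> D" "j < r" for d j
    using balanced[OF that] that by (auto simp: J_def)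
  have dr: "d ` {..<s} \<subseteq> {..<r}" if "d \<in> D" for d using D that by auto
  have cardJ: "s = r * q + card (J d)" if "d \<in> D" for d
  proof -
    have "s = (\<Sum>j<r. \<Sum>i\<in>{i \<in> {..<s}. d i = j}. 1)"
      using sum.group[OF finite_lessThan finite_lessThan dr[OF that], of "\<lambda>_. 1::nat"] by simp
    also have "\<dots> = (\<Sum>j<r. q + of_bool (j \<in> J d))"
      using class_size[OF that] by (intro sum.cong) auto
    also have "\<dots> = r * q + card ({..<r} \<inter> {j. j \<in> J d})"
      by (simp add: sum.distrib sum_of_bool_eq)
    also have "{..<r} \<inter> {j. j \<in> J d} = J d" by (auto simp: J_def)
    finally show ?thesis .
  qed
  have JT: "J d \<in> T" if "d \<in> D" for d
    using cardJ[OF that] by (auto simp: T_def t_def J_def)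
  have weight: "(\<Prod>i<s. a (d i)) = p ^ q * prod a (J d)" if "d \<in> D" for d
  proof -
    have "(\<Prod>i<s. a (d i)) = (\<Prod>j<r. \<Prod>i\<in>{i \<in> {..<s}. d i = j}. a (d i))"
      using prod.group[OF finite_lessThan finite_lessThan dr[OF that], of "\<lambda>i. a (d i)"] by simp
    also have "\<dots> = (\<Prod>j<r. a j ^ (q + of_bool (j \<in> J d)))"
    proof (rule prod.cong)
      fix j assume "j \<in> {..<r}"
      have "(\<Prod>i\<in>{i \<in> {..<s}. d i = j}. a (d i)) = (\<Prod>i\<in>{i. i < s \<and> d i = j}. a j)"
        by (rule prod.cong) auto
      thus "(\<Prod>i\<in>{i \<in> {..<s}. d i = j}. a (d i)) = a j ^ (q + of_bool (j \<in> J d))"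
        using class_size[OF that] \<open>j \<in> {..<r}\<close> by simp
    qed simp
    also have "\<dots> = (\<Prod>j<r. a j ^ q * (if j \<in> J d then a j else 1))"
      by (intro prod.cong) (auto simp: power_add)
    also have "\<dots> = p ^ q * (\<Prod>j<r. if j \<in> J d then a j else 1)"
      by (simp add: prod.distrib p_def prod_power_distrib)
    also have "(\<Prod>j<r. if j \<in> J d then a j else 1) = prod a ({..<r} \<inter> J d)"
      by (simp add: prod.inter_restrict)
    also have "{..<r} \<inter> J d = J d" by (auto simp: J_def)
    finally show ?thesis .
  qed
  have N_le: "N K \<le> N K'" if K: "K \<in> T" "K' \<in> T" for K K'
  proof -
    obtain \<pi> where \<pi>: "bij_betw \<pi> {..<r} {..<r}" "\<pi> ` K = K'"
      using ex_bij_betw_mapping_subset[of "{..<r}" K K'] K by (auto simp: T_def)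
    have inj: "inj_on \<pi> {..<r}" and onto: "\<pi> ` {..<r} = {..<r}"
      using \<pi>(1) by (auto simp: bij_betw_def)
    let ?h = "\<lambda>d. restrict (\<pi> \<circ> d) {..<s}"
    have Jh: "J (?h d) = \<pi> ` J d" if "d \<in> D" for d
    proof -
      have eq: "{i. i < s \<and> ?h d i = \<pi> j} = {i. i < s \<and> d i = j}" if "j < r" for j
        using inj_onD[OF inj] dr[OF \<open>d \<in> D\<close>] that by auto
      show ?thesis
      proof (intro equalityI subsetI)
        fix l assume l: "l \<in> J (?h d)"
        hence "l \<in> \<pi> ` {..<r}" using onto by (simp add: J_def)
        then obtain j where "j < r" "l = \<pi> j" by auto
        thus "l \<in> \<pi> ` J d" using l eq[of j] by (auto simp: J_def)
      next
        fix l assume "l \<in> \<pi> ` J d"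
        then obtain j where j: "j < r" "l = \<pi> j" "j \<in> J d" by (auto simp: J_def)
        have "\<pi> j < r" using onto j(1) by blast
        thus "l \<in> J (?h d)" using j eq[of j] by (simp add: J_def)
      qed
    qed
    have "inj_on ?h D"
    proof (rule inj_onI)
      fix d d' assume dd: "d \<in> D" "d' \<in> D" "?h d = ?h d'"
      show "d = d'"
      proof (rule PiE_ext[of _ "{..<s}" "\<lambda>_. {..<r}"])
        show "d \<in> {..<s} \<rightarrow>\<^sub>E {..<r}" "d' \<in> {..<s} \<rightarrow>\<^sub>E {..<r}" using D dd by auto
        fix i assume i: "i \<in> {..<s}"
        hence "\<pi> (d i) = \<pi> (d' i)" using fun_cong[OF dd(3), of i] by simp
        moreover have "d i \<in> {..<r}" "d' i \<in> {..<r}" using dr dd i by blast+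
        ultimately show "d i = d' i" using inj by (auto dest: inj_onD)
      qed
    qed
    hence "inj_on ?h {d \<in> D. J d = K}" by (rule inj_on_subset) auto
    moreover have "?h ` {d \<in> D. J d = K} \<subseteq> {d \<in> D. J d = K'}"
      using perm[OF _ \<pi>(1)] Jh \<pi>(2) by auto
    ultimately show ?thesis unfolding N_def using finD by (intro card_inj_on_le) auto
  qed
  show ?thesis
  proof (cases "D = {}")
    case False
    then obtain d0 where d0: "d0 \<in> D" by blast
    define n where "n = N (J d0)"
    have N: "N K = n" if "K \<in> T" for K
      unfolding n_def using N_le[OF that JT[OF d0]] N_le[OF JT[OF d0] that] by simp
    have group: "(\<Sum>d\<in>D. g (J d)) = real n * (\<Sum>K\<in>T. g K)" for g :: "nat set \<Rightarrow> real"
    proof -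
      have "(\<Sum>d\<in>D. g (J d)) = (\<Sum>K\<in>T. \<Sum>d\<in>{d \<in> D. J d = K}. g (J d))"
        using JT by (intro sum.group[symmetric] finD finT) auto
      also have "\<dots> = (\<Sum>K\<in>T. real n * g K)"
        using N by (intro sum.cong) (auto simp: N_def)
      finally show ?thesis by (simp add: sum_distrib_left)
    qed
    have cardD: "real (card D) = real n * real (r choose t)"
    proof -
      have "card T = r choose t" unfolding T_def by (simp add: n_subsets)
      thus ?thesis using group[of "\<lambda>_. 1"] by simp
    qed
    have \<mu>0: "\<mu> \<ge> 0" unfolding \<mu>_def using a by (intro divide_nonneg_nonneg sum_nonneg) auto
    have p0: "p \<ge> 0" unfolding p_def using a by (intro prod_nonneg) auto
    have elem: "(\<Sum>K | K \<subseteq> {..<r} \<and> card K = k. prod a K) \<le> real (r choose k) * \<mu> ^ k" for k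
      using maclaurin_inequality[of "{..<r}" a k] a by (simp add: \<mu>_def)
    have "{K. K \<subseteq> {..<r} \<and> card K = r} = {{..<r}}"
      using card_subset_eq[of "{..<r}"] by auto
    hence p_le: "p \<le> \<mu> ^ r" using elem[of r] by (simp add: p_def)
    have "(\<Sum>d\<in>D. \<Prod>i<s. a (d i)) = (\<Sum>d\<in>D. p ^ q * prod a (J d))"
      using weight by (intro sum.cong) auto
    also have "\<dots> = real n * (\<Sum>K\<in>T. p ^ q * prod a K)" by (rule group)
    also have "\<dots> = real n * (p ^ q * (\<Sum>K\<in>T. prod a K))" by (simp only: sum_distrib_left)
    also have "\<dots> \<le> real n * ((\<mu> ^ r) ^ q * (real (r choose t) * \<mu> ^ t))"
      unfolding T_def using elem[of t] p_le p0 \<mu>0 a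
      by (intro mult_left_mono mult_mono power_mono sum_nonneg prod_nonneg) auto
    also have "\<dots> = real (card D) * \<mu> ^ (r * q + t)"
      by (simp add: cardD power_add power_mult)
    also have "r * q + t = s" using cardJ[OF d0] by (simp add: t_def)
    finally show ?thesis by (simp add: \<mu>_def)
  qed simp
qed

section \<open>Patterns that realize a Turan graph\<close>

definition pattern_graph :: "nat \<Rightarrow> (nat \<times> nat) set \<Rightarrow> nat graph" where
  "pattern_graph s A = Graph {..<s} {{i, j} | i j. i < s \<and> j < s \<and> i \<noteq> j \<and> (i, j) \<in> A}"

definition realizes :: "'a graph \<Rightarrow> (nat \<times> nat) set \<Rightarrow> bool" where
  "realizes F A \<longleftrightarrow> graph_iso (pattern_graph (card (verts F)) A) F"

text \<open>
  Turan graphs with a named partition, so that facts about its parts can be stated.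
\<close>

definition turan_partition :: "nat \<Rightarrow> nat \<Rightarrow> 'a graph \<Rightarrow> ('a \<Rightarrow> nat) \<Rightarrow> bool" where
  "turan_partition s r F p \<longleftrightarrow>
     finite (verts F) \<and> card (verts F) = s \<and> p ` verts F \<subseteq> {..<r} \<and>
     edges F = {{u, v} | u v. u \<in> verts F \<and> v \<in> verts F \<and> p u \<noteq> p v} \<and>
     (\<forall>i<r. \<forall>j<r. card {v \<in> verts F. p v = i} \<le> card {v \<in> verts F. p v = j} + 1)"

lemma turan_graph_iff_partition: "turan_graph s r F \<longleftrightarrow> (\<exists>p. turan_partition s r F p)"
  unfolding turan_graph_def turan_partition_def by simp

lemma verts_pattern_graph [simp]: "verts (pattern_graph s A) = {..<s}"
  by (simp add: pattern_graph_def)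

lemma pattern_graph_edge:
  "sym A \<Longrightarrow> i < s \<Longrightarrow> j < s \<Longrightarrow> {i, j} \<in> edges (pattern_graph s A) \<longleftrightarrow> i \<noteq> j \<and> (i, j) \<in> A"
  by (auto simp: pattern_graph_def doubleton_eq_iff sym_def)

text \<open>
  Pulling the partition of \<open>F\<close> back along an isomorphism colours the indices.
\<close>

lemma realizes_colouring:
  assumes tp: "turan_partition s r F p" and A: "realizes F A" "sym A" "irrefl A"
  obtains c where "c ` {..<s} \<subseteq> {..<r}"
    "\<And>i j. i < s \<Longrightarrow> j < s \<Longrightarrow> (i, j) \<in> A \<longleftrightarrow> c i \<noteq> c j"
    "\<And>l. card {i. i < s \<and> c i = l} = card {v \<in> verts F. p v = l}"
proof -
  have s: "card (verts F) = s" and pr: "p ` verts F \<subseteq> {..<r}"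
    and edges: "edges F = {{u, v} | u v. u \<in> verts F \<and> v \<in> verts F \<and> p u \<noteq> p v}"
    using tp by (simp_all add: turan_partition_def)
  obtain f where f: "bij_betw f {..<s} (verts F)"
    and iso: "\<And>i j. i < s \<Longrightarrow> j < s \<Longrightarrow> {i, j} \<in> edges (pattern_graph s A) \<longleftrightarrow> {f i, f j} \<in> edges F"
    using A(1) unfolding realizes_def graph_iso_def s by auto
  have fV: "f i \<in> verts F" if "i < s" for i using f that by (auto simp: bij_betw_def)
  show ?thesis
  proof (rule that[of "p \<circ> f"])
    show "(p \<circ> f) ` {..<s} \<subseteq> {..<r}" using fV pr by auto
    fix i j assume ij: "i < s" "j < s"
    have "{f i, f j} \<in> edges F \<longleftrightarrow> p (f i) \<noteq> p (f j)"
      unfolding edges using fV[OF ij(1)] fV[OF ij(2)] by (auto simp: doubleton_eq_iff)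
    thus "(i, j) \<in> A \<longleftrightarrow> (p \<circ> f) i \<noteq> (p \<circ> f) j"
      using iso[OF ij] pattern_graph_edge[OF A(2) ij] A(3) by (auto simp: irrefl_def)
  next
    fix l
    have "bij_betw f {i. i < s \<and> (p \<circ> f) i = l} {v \<in> verts F. p v = l}"
      using f by (auto simp: bij_betw_def inj_on_def)
    thus "card {i. i < s \<and> (p \<circ> f) i = l} = card {v \<in> verts F. p v = l}"
      by (rule bij_betw_same_card)
  qed
qed

lemma realizes_forces_multipartite:
  assumes "turan_partition s r F p"
  shows "forces_multipartite s (realizes F)"
  unfolding forces_multipartite_def
proof (intro allI impI)
  fix A i j k
  assume A: "realizes F A" "sym A" "irrefl A" and ijk: "i < s" "j < s" "k < s"
    and n: "(i, j) \<notin> A" "(j, k) \<notin> A"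
  obtain c :: "nat \<Rightarrow> nat" where "\<And>i j. i < s \<Longrightarrow> j < s \<Longrightarrow> (i, j) \<in> A \<longleftrightarrow> c i \<noteq> c j"
    by (rule realizes_colouring[OF assms A]) blast
  thus "(i, k) \<notin> A" using ijk n by metis
qed

text \<open>
  Here \<open>q\<close> is the smallest part size. An empty part would force all parts to have at most one
  vertex, hence fewer than \<open>r\<close> vertices in total; this is where \<open>r \<le> s\<close> enters.
\<close>

lemma turan_partition_sizes:
  assumes tp: "turan_partition s r F p" and r: "0 < r" "r \<le> s"
  obtains q where "\<And>l. l < r \<Longrightarrow> card {v \<in> verts F. p v = l} \<in> {q, Suc q}"
    "\<And>l. l < r \<Longrightarrow> 0 < card {v \<in> verts F. p v = l}"
proof -
  define b where "b l = card {v \<in> verts F. p v = l}" for l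
  have b1: "b i \<le> b j + 1" if "i < r" "j < r" for i j
    using tp that by (simp add: turan_partition_def b_def)
  define q where "q = Min (b ` {..<r})"
  have "q \<in> b ` {..<r}" unfolding q_def using r(1) by (intro Min_in) auto
  then obtain j where j: "j < r" "b j = q" by auto
  have qle: "q \<le> b l" if "l < r" for l unfolding q_def using that by (intro Min_le) auto
  have bq: "b l \<in> {q, Suc q}" if "l < r" for l using b1[OF that j(1)] qle[OF that] j(2) by auto
  have sum_b: "(\<Sum>l<r. b l) = s"
    using sum.group[of "verts F" "{..<r}" p "\<lambda>_. 1::nat"] tp
    by (simp add: turan_partition_def b_def)
  have "0 < b l" if l: "l < r" for l
  proof (rule ccontr)
    assume "\<not> 0 < b l"
    hence "b l = 0" by simp
    have "(\<Sum>k<r. b k) = b l + (\<Sum>k\<in>{..<r} - {l}. b k)"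
      using l by (intro sum.remove) auto
    also have "\<dots> \<le> 0 + (\<Sum>k\<in>{..<r} - {l}. 1)"
      using b1[OF _ l] \<open>b l = 0\<close> by (intro add_mono sum_mono) auto
    also have "\<dots> < r" using l by simp
    finally show False using sum_b r(2) by simp
  qed
  thus ?thesis using that[of q] bq by (simp add: b_def)
qed

lemma good_colourings_balanced:
  assumes tp: "turan_partition s r F p" and r: "0 < r" "r \<le> s"
  obtains q where "\<And>d j. d \<in> good_colourings s r (realizes F) \<Longrightarrow> j < r \<Longrightarrow>
    card {i. i < s \<and> d i = j} \<in> {q, Suc q}"
proof -
  obtain q where q: "\<And>l. l < r \<Longrightarrow> card {v \<in> verts F. p v = l} \<in> {q, Suc q}"
    and pos: "\<And>l. l < r \<Longrightarrow> 0 < card {v \<in> verts F. p v = l}"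
    by (rule turan_partition_sizes[OF tp r]) blast
  have "card {i. i < s \<and> d i = j} \<in> {q, Suc q}"
    if d: "d \<in> good_colourings s r (realizes F)" and j: "j < r" for d j
  proof -
    let ?A = "adjacency_pattern s (\<noteq>) d"
    have dr: "d ` {..<s} \<subseteq> {..<r}" and \<Phi>: "realizes F ?A"
      using d by (auto simp: good_colourings_def)
    have "symp ((\<noteq>) :: nat \<Rightarrow> nat \<Rightarrow> bool)" "irreflp ((\<noteq>) :: nat \<Rightarrow> nat \<Rightarrow> bool)"
      by (auto simp: symp_def irreflp_def)
    note A = sym_adjacency_pattern[OF this(1), of s d] irrefl_adjacency_pattern[OF this(2), of s d]
    obtain c where c: "c ` {..<s} \<subseteq> {..<r}"
      and Ac: "\<And>i j. i < s \<Longrightarrow> j < s \<Longrightarrow> (i, j) \<in> ?A \<longleftrightarrow> c i \<noteq> c j"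
      and sz: "\<And>l. card {i. i < s \<and> c i = l} = card {v \<in> verts F. p v = l}"
      by (rule realizes_colouring[OF tp \<Phi> A]) blast
    have dc: "d i = d k \<longleftrightarrow> c i = c k" if "i < s" "k < s" for i k
      using Ac[OF that] that by (auto simp: adjacency_pattern_def)
    \<comment> \<open>Every part of \<open>F\<close> is inhabited, so representatives of the parts get distinct colours
      under \<open>d\<close>, and by counting every colour of \<open>d\<close> is used.\<close>
    have "\<exists>i<s. c i = l" if "l < r" for l
    proof -
      have "{i. i < s \<and> c i = l} \<noteq> {}" using pos[OF that] sz[of l] by (metis card.empty less_irrefl)
      thus ?thesis by blast
    qed
    then obtain g where g: "\<And>l. l < r \<Longrightarrow> g l < s \<and> c (g l) = l" by metis
    have "inj_on (d \<circ> g) {..<r}"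
      by (rule inj_onI) (metis comp_apply dc g lessThan_iff)
    moreover have "(d \<circ> g) ` {..<r} \<subseteq> {..<r}" using g dr by auto
    ultimately have "(d \<circ> g) ` {..<r} = {..<r}" by (intro endo_inj_surj) auto
    then obtain l where l: "l < r" "d (g l) = j" using j by (metis comp_apply imageE lessThan_iff)
    have "{i. i < s \<and> d i = j} = {i. i < s \<and> c i = l}"
      using dc g[OF l(1)] l(2) by auto
    thus ?thesis using sz[of l] q[OF l(1)] by simp
  qed
  thus ?thesis by (rule that)
qed

lemma good_colourings_permute:
  assumes d: "d \<in> good_colourings s r \<Phi>" and \<pi>: "bij_betw \<pi> {..<r} {..<r}"
  shows "restrict (\<pi> \<circ> d) {..<s} \<in> good_colourings s r \<Phi>"
proof -
  have dr: "d i < r" if "i < s" for i using d that by (auto simp: good_colourings_def)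
  have "\<pi> (d i) = \<pi> (d j) \<longleftrightarrow> d i = d j" if "i < s" "j < s" for i j
    using inj_on_eq_iff[OF bij_betw_imp_inj_on[OF \<pi>]] dr that by simp
  hence "adjacency_pattern s (\<noteq>) (restrict (\<pi> \<circ> d) {..<s}) = adjacency_pattern s (\<noteq>) d"
    by (auto simp: adjacency_pattern_def)
  moreover have "\<pi> (d i) < r" if "i < s" for i
    using \<pi> dr[OF that] by (auto simp: bij_betw_def)
  ultimately show ?thesis using d by (auto simp: good_colourings_def)
qed

text \<open>
  Since sequences may repeat vertices, the proportion of sequences realizing \<open>F\<close> is the density
  of \<open>F\<close> in the graphon of the graph. This is why the bound is exact for every \<open>V\<close>, without an
  error term.
\<close>

lemma pattern_count_clique_free_le:
  assumes tp: "turan_partition s r F p" and r: "0 < r" "r \<le> s"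
    and V: "finite V" and E: "symp E" "irreflp E" "clique_free (Suc r) V E"
  shows "real (pattern_count s (realizes F) V E)
    \<le> real (card (good_colourings s r (realizes F))) * (real (card V) / real r) ^ s"
proof -
  obtain E' where E': "symp E'" "irreflp E'" "clique_free (Suc r) V E'"
    and le: "pattern_count s (realizes F) V E \<le> pattern_count s (realizes F) V E'"
    and trans: "\<And>u v w. \<lbrakk>u \<in> V; v \<in> V; w \<in> V; \<not> E' u v; \<not> E' v w\<rbrakk> \<Longrightarrow> \<not> E' u w"
    by (rule symmetrization[OF realizes_forces_multipartite[OF tp] V E]) blast
  obtain c where c: "c ` V \<subseteq> {..<r}" "\<And>x y. \<lbrakk>x \<in> V; y \<in> V\<rbrakk> \<Longrightarrow> E' x y \<longleftrightarrow> c x \<noteq> c y"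
    by (rule multipartite_colouring[OF V E']) (erule (4) trans, blast)
  define a where "a j = real (card {v \<in> V. c v = j})" for j
  obtain q where q: "\<And>d j. d \<in> good_colourings s r (realizes F) \<Longrightarrow> j < r \<Longrightarrow>
    card {i. i < s \<and> d i = j} \<in> {q, Suc q}"
    by (rule good_colourings_balanced[OF tp r]) blast
  have "real (pattern_count s (realizes F) V E')
      = (\<Sum>d\<in>good_colourings s r (realizes F). \<Prod>i<s. a (d i))"
    by (simp add: pattern_count_multipartite[OF V c] a_def)
  also have "\<dots> \<le> real (card (good_colourings s r (realizes F))) * ((\<Sum>j<r. a j) / real r) ^ s"
  proof (rule balanced_colourings_bound[where q = q])
    show "good_colourings s r (realizes F) \<subseteq> {..<s} \<rightarrow>\<^sub>E {..<r}"
      by (auto simp: good_colourings_def)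
  qed (use q good_colourings_permute in \<open>auto simp: a_def\<close>)
  also have "(\<Sum>j<r. a j) = real (card V)"
    using sum.group[OF V finite_lessThan c(1), of "\<lambda>_. 1::real"] by (simp add: a_def)
  finally show ?thesis using le by simp
qed

section \<open>Induced copies as injective vertex sequences\<close>

lemma graph_iso_sym:
  assumes "graph_iso G H"
  shows "graph_iso H G"
proof -
  obtain f where f: "bij_betw f (verts G) (verts H)"
    and iso: "\<And>u v. u \<in> verts G \<Longrightarrow> v \<in> verts G \<Longrightarrow> {u, v} \<in> edges G \<longleftrightarrow> {f u, f v} \<in> edges H"
    using assms unfolding graph_iso_def by blast
  let ?g = "inv_into (verts G) f"
  have "?g v \<in> verts G" "f (?g v) = v" if "v \<in> verts H" for v
    using that f by (auto simp: bij_betw_def inv_into_into f_inv_into_f)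
  thus ?thesis
    unfolding graph_iso_def using bij_betw_inv_into[OF f] iso by (intro exI[of _ ?g]) auto
qed

lemma graph_iso_trans:
  assumes "graph_iso G H" "graph_iso H K"
  shows "graph_iso G K"
proof -
  obtain f where f: "bij_betw f (verts G) (verts H)"
    and f': "\<And>u v. u \<in> verts G \<Longrightarrow> v \<in> verts G \<Longrightarrow> {u, v} \<in> edges G \<longleftrightarrow> {f u, f v} \<in> edges H"
    using assms(1) unfolding graph_iso_def by blast
  obtain g where g: "bij_betw g (verts H) (verts K)"
    and g': "\<And>u v. u \<in> verts H \<Longrightarrow> v \<in> verts H \<Longrightarrow> {u, v} \<in> edges H \<longleftrightarrow> {g u, g v} \<in> edges K"
    using assms(2) unfolding graph_iso_def by blast
  have "f u \<in> verts H" if "u \<in> verts G" for u using f that by (auto simp: bij_betw_def)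
  thus ?thesis
    unfolding graph_iso_def using bij_betw_trans[OF f g] f' g' by (intro exI[of _ "g \<circ> f"]) auto
qed

definition adjacent :: "'a graph \<Rightarrow> 'a \<Rightarrow> 'a \<Rightarrow> bool" where
  "adjacent G x y \<longleftrightarrow> {x, y} \<in> edges G"

lemma symp_adjacent: "symp (adjacent G)"
  by (simp add: symp_def adjacent_def insert_commute)

lemma irreflp_adjacent: "simple_graph G \<Longrightarrow> irreflp (adjacent G)"
  by (auto simp: simple_graph_def irreflp_def adjacent_def)

lemma clique_free_adjacent:
  assumes "simple_graph G" "\<not> contains_subgraph G (complete_graph k)"
  shows "clique_free k (verts G) (adjacent G)"
  unfolding clique_free_def
proof
  assume "\<exists>f. f ` {..<k} \<subseteq> verts G \<and> (\<forall>i<k. \<forall>j<k. i \<noteq> j \<longrightarrow> adjacent G (f i) (f j))"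
  then obtain f where f: "f ` {..<k} \<subseteq> verts G"
    and adj: "\<And>i j. i < k \<Longrightarrow> j < k \<Longrightarrow> i \<noteq> j \<Longrightarrow> adjacent G (f i) (f j)" by blast
  have "inj_on f {..<k}"
    by (rule inj_onI) (metis adj irreflp_adjacent[OF assms(1)] irreflpD lessThan_iff)
  moreover have "{f i, f j} \<in> edges G" if "{i, j} \<in> edges (complete_graph k)" "i < k" "j < k" for i j
    using that adj[of i j] by (cases "i = j") (auto simp: complete_graph_def adjacent_def)
  ultimately have "contains_subgraph G (complete_graph k)"
    unfolding contains_subgraph_def using f by (intro exI[of _ f]) (auto simp: complete_graph_def)
  thus False using assms(2) by contradiction
qed

lemma pattern_graph_iso_induced:
  assumes G: "simple_graph G" and x: "bij_betw x {..<s} S" and S: "S \<subseteq> verts G"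
  shows "graph_iso (pattern_graph s (adjacency_pattern s (adjacent G) x)) (induced G S)"
  unfolding graph_iso_def
proof (intro exI[of _ x] conjI ballI)
  show "bij_betw x (verts (pattern_graph s (adjacency_pattern s (adjacent G) x))) (verts (induced G S))"
    using x by (simp add: induced_def)
  fix i j assume "i \<in> verts (pattern_graph s (adjacency_pattern s (adjacent G) x))"
    "j \<in> verts (pattern_graph s (adjacency_pattern s (adjacent G) x))"
  hence ij: "i < s" "j < s" by simp_all
  hence "{x i, x j} \<subseteq> S" using x by (auto simp: bij_betw_def)
  moreover have "i \<noteq> j" if "{x i, x j} \<in> edges G" using that G by (auto simp: simple_graph_def)
  ultimately show "{i, j} \<in> edges (pattern_graph s (adjacency_pattern s (adjacent G) x))
      \<longleftrightarrow> {x i, x j} \<in> edges (induced G S)"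
    using ij pattern_graph_edge[OF sym_adjacency_pattern[OF symp_adjacent] ij]
    by (auto simp: induced_def adjacency_pattern_def adjacent_def)
qed

lemma fact_binomial_eq_falling:
  assumes "s \<le> n"
  shows "fact s * (n choose s) = (\<Prod>i = 0..<s. n - i)"
proof -
  have "real (fact s * (n choose s)) = (\<Prod>i = 0..<s. real n - real i)"
    using gbinomial_mult_fact[of s "real n"] by (simp add: binomial_gbinomial)
  also have "\<dots> = real (\<Prod>i = 0..<s. n - i)"
    using assms by (simp add: of_nat_diff)
  finally show ?thesis by (simp only: of_nat_eq_iff)
qed

lemma card_injective_maps:
  assumes "finite S" "s \<le> card S"
  shows "card {x \<in> {..<s} \<rightarrow>\<^sub>E S. inj_on x {..<s}} = fact s * (card S choose s)"
  using card_inj_on_subset_funcset[of "{..<s}" S "{..<s}"] assms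
  by (simp add: fact_binomial_eq_falling)

text \<open>
  Each vertex set inducing a copy of \<open>F\<close> is enumerated by \<open>fact s\<close> injective sequences, and
  whether the pattern realizes \<open>F\<close> depends only on the enumerated set.
\<close>

lemma card_injective_realizations:
  assumes G: "simple_graph G" and s: "card (verts F) = s"
  shows "card {x \<in> {..<s} \<rightarrow>\<^sub>E verts G. inj_on x {..<s} \<and> realizes F (adjacency_pattern s (adjacent G) x)}
    = fact s * induced_count F G"
proof -
  define C where "C = {S. S \<subseteq> verts G \<and> card S = s \<and> graph_iso (induced G S) F}"
  have fin: "finite (verts G)" using G by (simp add: simple_graph_def)
  have finS: "finite S" if "S \<in> C" for S using that fin by (auto simp: C_def intro: finite_subset)
  have finC: "finite C" using fin by (auto simp: C_def intro: finite_subset[of _ "Pow (verts G)"])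
  let ?B = "\<lambda>S. {x \<in> {..<s} \<rightarrow>\<^sub>E S. inj_on x {..<s}}"
  have img: "x ` {..<s} = S" if "S \<in> C" "x \<in> ?B S" for x S
    using that finS[OF that(1)] by (intro card_subset_eq) (auto simp: C_def card_image)
  have iso: "realizes F (adjacency_pattern s (adjacent G) x) \<longleftrightarrow> graph_iso (induced G S) F"
    if "bij_betw x {..<s} S" "S \<subseteq> verts G" for x S
    unfolding realizes_def s using pattern_graph_iso_induced[OF G that]
    by (meson graph_iso_sym graph_iso_trans)
  have "{x \<in> {..<s} \<rightarrow>\<^sub>E verts G. inj_on x {..<s} \<and> realizes F (adjacency_pattern s (adjacent G) x)}
      = (\<Union>S\<in>C. ?B S)"
  proof (intro equalityI subsetI)
    fix x assume x: "x \<in> {x \<in> {..<s} \<rightarrow>\<^sub>E verts G. inj_on x {..<s} \<and>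
        realizes F (adjacency_pattern s (adjacent G) x)}"
    have sub: "x ` {..<s} \<subseteq> verts G" and bij: "bij_betw x {..<s} (x ` {..<s})"
      using x by (auto simp: bij_betw_def)
    have "x ` {..<s} \<in> C" using x sub iso[OF bij sub] by (simp add: C_def card_image)
    moreover have "x \<in> ?B (x ` {..<s})" using x by (auto simp: PiE_def Pi_def)
    ultimately show "x \<in> (\<Union>S\<in>C. ?B S)" by blast
  next
    fix x assume "x \<in> (\<Union>S\<in>C. ?B S)"
    then obtain S where S: "S \<in> C" "x \<in> ?B S" by blast
    have sub: "S \<subseteq> verts G" using S by (simp add: C_def)
    have "bij_betw x {..<s} S" using S img[OF S] by (simp add: bij_betw_def)
    hence "realizes F (adjacency_pattern s (adjacent G) x)"
      using iso[OF _ sub] S(1) by (simp add: C_def)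
    thus "x \<in> {x \<in> {..<s} \<rightarrow>\<^sub>E verts G. inj_on x {..<s} \<and> realizes F (adjacency_pattern s (adjacent G) x)}"
      using S sub by (auto simp: PiE_def Pi_def)
  qed
  moreover have "card (\<Union>S\<in>C. ?B S) = (\<Sum>S\<in>C. card (?B S))"
  proof (rule card_UN_disjoint[OF finC])
    show "\<forall>S\<in>C. finite (?B S)" using finS by (simp add: finite_PiE)
    have "S = S'" if "S \<in> C" "S' \<in> C" "x \<in> ?B S" "x \<in> ?B S'" for S S' x
      using img[OF that(1,3)] img[OF that(2,4)] by simp
    thus "\<forall>S\<in>C. \<forall>S'\<in>C. S \<noteq> S' \<longrightarrow> ?B S \<inter> ?B S' = {}"
      by (metis (no_types, lifting) disjoint_iff)
  qed
  moreover have "card (?B S) = fact s" if "S \<in> C" for S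
    using card_injective_maps[OF finS[OF that], of s] that by (simp add: C_def)
  ultimately show ?thesis by (simp add: induced_count_def C_def s)
qed

section \<open>The inducibility of a Turan graph\<close>

lemma power_over_falling_factorial_tendsto:
  "(\<lambda>n. real n ^ s / real (fact s * (n choose s))) \<longlonglongrightarrow> 1"
proof -
  have factor: "(\<lambda>n. (real n - real i) / real n) \<longlonglongrightarrow> 1" for i
  proof -
    have "(\<lambda>n. 1 - real i / real n) \<longlonglongrightarrow> 1 - 0"
      by (intro tendsto_diff tendsto_const lim_const_over_n)
    moreover have "\<forall>\<^sub>F n in sequentially. 1 - real i / real n = (real n - real i) / real n"
      using eventually_gt_at_top[of 0] by eventually_elim (simp add: field_simps)
    ultimately show ?thesis by (auto intro: Lim_transform_eventually)
  qed
  have "(\<lambda>n. inverse (\<Prod>i = 0..<s. (real n - real i) / real n)) \<longlonglongrightarrow> inverse (\<Prod>i = 0..<s. 1)"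
    by (intro tendsto_inverse tendsto_prod factor) simp
  moreover have "inverse (\<Prod>i = 0..<s. (real n - real i) / real n)
      = real n ^ s / real (fact s * (n choose s))" for n
    using gbinomial_mult_fact[of s "real n"]
    by (simp add: prod_dividef binomial_gbinomial)
  ultimately show ?thesis by simp
qed

lemma induced_density_le:
  assumes tp: "turan_partition s r F p" and r: "0 < r" "r \<le> s"
    and G: "G \<in> free_graphs (Suc r) n"
  shows "induced_density F G \<le> real (card (good_colourings s r (realizes F))) / real r ^ s
    * (real n ^ s / real (fact s * (n choose s)))"
proof -
  have sG: "simple_graph G" and n: "card (verts G) = n"
    and free: "\<not> contains_subgraph G (complete_graph (Suc r))"
    using G by (simp_all add: free_graphs_def)
  have fin: "finite (verts G)" using sG by (simp add: simple_graph_def)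
  have s: "card (verts F) = s" using tp by (simp add: turan_partition_def)
  let ?D = "card (good_colourings s r (realizes F))"
  have "fact s * induced_count F G \<le> pattern_count s (realizes F) (verts G) (adjacent G)"
    unfolding card_injective_realizations[OF sG s, symmetric] pattern_count_def
    using fin by (intro card_mono) (auto simp: finite_PiE)
  hence "real (fact s * induced_count F G) \<le> real ?D * (real n / real r) ^ s"
    using pattern_count_clique_free_le[OF tp r fin symp_adjacent irreflp_adjacent[OF sG]
        clique_free_adjacent[OF sG free]]
    unfolding n by (meson of_nat_le_iff order_trans)
  hence "real (fact s * induced_count F G) / real (fact s * (n choose s))
      \<le> real ?D * (real n / real r) ^ s / real (fact s * (n choose s))"
    by (rule divide_right_mono) simp
  thus ?thesis by (simp add: induced_density_def n s power_divide)
qed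

text \<open>
  The witness is the Turan graph on \<open>n\<close> vertices with \<open>r\<close> parts of equal size, in which the
  sequences realizing \<open>F\<close> are counted exactly. Passing to induced copies loses at most the
  sequences with a repetition, which are all but \<open>fact s * (n choose s)\<close> of the \<open>n ^ s\<close> sequences.
\<close>

lemma balanced_multipartite_density_ge:
  assumes tp: "turan_partition s r F p" and r: "0 < r" and n: "n = r * m" "s \<le> n"
  shows "real (card (good_colourings s r (realizes F))) / real r ^ s
      * (real n ^ s / real (fact s * (n choose s))) - real n ^ s / real (fact s * (n choose s)) + 1
    \<le> max_induced_density (Suc r) F n"
proof -
  define G where "G = Graph {..<n} {{u, v} | u v. u < n \<and> v < n \<and> u mod r \<noteq> v mod r}"
  have vG: "verts G = {..<n}" by (simp add: G_def)
  have sG: "simple_graph G"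
    unfolding G_def by (rule turan_graph_simple[OF turan_graph_exists[OF r]])
  have adj: "adjacent G x y \<longleftrightarrow> x mod r \<noteq> y mod r" if "x \<in> {..<n}" "y \<in> {..<n}" for x y
    using that by (auto simp: adjacent_def G_def doubleton_eq_iff)
  have "\<not> contains_subgraph G (complete_graph (Suc r))"
  proof
    assume "contains_subgraph G (complete_graph (Suc r))"
    then obtain f where f: "f ` {..<Suc r} \<subseteq> {..<n}"
      and e: "\<And>i j. i < Suc r \<Longrightarrow> j < Suc r \<Longrightarrow> {i, j} \<in> edges (complete_graph (Suc r)) \<Longrightarrow>
        adjacent G (f i) (f j)"
      unfolding contains_subgraph_def by (auto simp: complete_graph_def adjacent_def vG)
    have "inj_on (\<lambda>i. f i mod r) {..<Suc r}"
    proof (rule inj_onI, rule ccontr)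
      fix i j assume ij: "i \<in> {..<Suc r}" "j \<in> {..<Suc r}" "f i mod r = f j mod r" "i \<noteq> j"
      hence "adjacent G (f i) (f j)" by (intro e) (auto simp: complete_graph_def)
      moreover have "f i \<in> {..<n}" "f j \<in> {..<n}" using f ij by auto
      ultimately show False using ij adj by simp
    qed
    moreover have "(\<lambda>i. f i mod r) ` {..<Suc r} \<subseteq> {..<r}" using r by auto
    ultimately have "card {..<Suc r} \<le> card {..<r}" by (intro card_inj_on_le) auto
    thus False by simp
  qed
  hence free: "G \<in> free_graphs (Suc r) n" by (simp add: free_graphs_def sG vG)
  have s: "card (verts F) = s" using tp by (simp add: turan_partition_def)
  let ?D = "card (good_colourings s r (realizes F))"
  let ?C = "n choose s"
  let ?X = "{..<s} \<rightarrow>\<^sub>E {..<n}"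
  have "pattern_count s (realizes F) {..<n} (adjacent G)
      = (\<Sum>d\<in>good_colourings s r (realizes F). \<Prod>i<s. card {v \<in> {..<n}. v mod r = d i})"
    by (rule pattern_count_multipartite) (use r adj in auto)
  also have "\<dots> = (\<Sum>d\<in>good_colourings s r (realizes F). \<Prod>i<s. m)"
  proof (intro sum.cong prod.cong refl)
    fix d i assume "d \<in> good_colourings s r (realizes F)" "i \<in> {..<s}"
    hence "d i < r" by (auto simp: good_colourings_def)
    thus "card {v \<in> {..<n}. v mod r = d i} = m"
      using card_mod_class[of "d i" r n] r by (simp add: n)
  qed
  finally have count: "pattern_count s (realizes F) {..<n} (adjacent G) = ?D * m ^ s" by simp
  let ?\<Phi> = "\<lambda>x. realizes F (adjacency_pattern s (adjacent G) x)"
  have "card {x \<in> ?X. ?\<Phi> x} + fact s * ?C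
      \<le> card {x \<in> ?X. inj_on x {..<s} \<and> ?\<Phi> x} + card ?X"
  proof -
    have finX: "finite ?X" by (simp add: finite_PiE)
    have "card {x \<in> ?X. ?\<Phi> x} + card {x \<in> ?X. inj_on x {..<s}}
      = card ({x \<in> ?X. ?\<Phi> x} \<union> {x \<in> ?X. inj_on x {..<s}})
        + card ({x \<in> ?X. ?\<Phi> x} \<inter> {x \<in> ?X. inj_on x {..<s}})"
      using finX by (intro card_Un_Int) auto
    also have "{x \<in> ?X. ?\<Phi> x} \<inter> {x \<in> ?X. inj_on x {..<s}} = {x \<in> ?X. inj_on x {..<s} \<and> ?\<Phi> x}"
      by blast
    also have "card ({x \<in> ?X. ?\<Phi> x} \<union> {x \<in> ?X. inj_on x {..<s}}) \<le> card ?X"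
      using finX by (intro card_mono) auto
    finally show ?thesis using card_injective_maps[of "{..<n}" s] n(2) by simp
  qed
  hence "?D * m ^ s + fact s * ?C \<le> fact s * induced_count F G + n ^ s"
    using card_injective_realizations[OF sG s] count
    by (simp add: pattern_count_def vG card_PiE)
  hence "real (?D * m ^ s + fact s * ?C) \<le> real (fact s * induced_count F G + n ^ s)"
    by (simp only: of_nat_le_iff)
  hence "real ?D / real r ^ s * real n ^ s - real n ^ s + real (fact s * ?C)
      \<le> real (fact s * induced_count F G)"
    using r by (simp add: n(1) power_mult_distrib)
  hence "(real ?D / real r ^ s * real n ^ s - real n ^ s + real (fact s * ?C)) / real (fact s * ?C)
      \<le> real (fact s * induced_count F G) / real (fact s * ?C)"
    by (rule divide_right_mono) simp
  moreover have "real (fact s * induced_count F G) / real (fact s * ?C) = induced_density F G"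
    by (simp add: induced_density_def s vG)
  moreover have "real (fact s * ?C) \<noteq> 0" using n(2) by simp
  ultimately have "real ?D / real r ^ s * (real n ^ s / real (fact s * ?C))
      - real n ^ s / real (fact s * ?C) + 1 \<le> induced_density F G"
    by (simp only: add_divide_distrib diff_divide_distrib times_divide_eq_right divide_self
        not_False_eq_True)
  thus ?thesis using induced_density_le_max[OF free, of F] by simp
qed

text \<open>
  The upper and the lower bound are affine in \<open>n ^ s / (fact s * (n choose s))\<close>, which tends
  to 1, and at the value 1 both equal the right-hand side. Since the limit exists, the lower bound is only needed for multiples of \<open>r\<close>.
\<close>

lemma inducibility_turan_graph:
  assumes tp: "turan_partition s r F p" and r: "0 < r" "r \<le> s"
  shows "inducibility (Suc r) F = real (card (good_colourings s r (realizes F))) / real r ^ s"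
proof -
  define \<delta> where "\<delta> = real (card (good_colourings s r (realizes F))) / real r ^ s"
  define \<rho> where "\<rho> n = real n ^ s / real (fact s * (n choose s))" for n
  have \<rho>: "\<rho> \<longlonglongrightarrow> 1" unfolding \<rho>_def by (rule power_over_falling_factorial_tendsto)
  have k: "2 \<le> Suc r" using r by simp
  obtain L where L: "(\<lambda>n. max_induced_density (Suc r) F n) \<longlonglongrightarrow> L"
    using max_induced_density_convergent[OF k, of F] by (auto simp: convergent_def)
  have upper: "max_induced_density (Suc r) F n \<le> \<delta> * \<rho> n" for n
    by (rule max_induced_density_attained[OF k, of n F])
      (use induced_density_le[OF tp r] in \<open>simp add: \<delta>_def \<rho>_def\<close>)
  have "L \<le> \<delta> * 1"
    by (rule LIMSEQ_le[OF L tendsto_mult[OF tendsto_const \<rho>]]) (use upper in auto)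
  moreover have "\<delta> * 1 - 1 + 1 \<le> L"
  proof (rule LIMSEQ_le)
    have sub: "strict_mono (\<lambda>m. r * m)" using r(1) by (simp add: strict_mono_def)
    show "(\<lambda>m. \<delta> * \<rho> (r * m) - \<rho> (r * m) + 1) \<longlonglongrightarrow> \<delta> * 1 - 1 + 1"
      using LIMSEQ_subseq_LIMSEQ[OF \<rho> sub] by (intro tendsto_intros) (simp_all add: o_def)
    show "(\<lambda>m. max_induced_density (Suc r) F (r * m)) \<longlonglongrightarrow> L"
      using LIMSEQ_subseq_LIMSEQ[OF L sub] by (simp add: o_def)
    have "\<delta> * \<rho> (r * m) - \<rho> (r * m) + 1 \<le> max_induced_density (Suc r) F (r * m)" if "s \<le> m" for m
    proof -
      have "m \<le> r * m" using r(1) by simp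
      hence "s \<le> r * m" using that by linarith
      from balanced_multipartite_density_ge[OF tp r(1) refl this] show ?thesis
        unfolding \<delta>_def \<rho>_def .
    qed
    thus "\<exists>N. \<forall>m\<ge>N. \<delta> * \<rho> (r * m) - \<rho> (r * m) + 1 \<le> max_induced_density (Suc r) F (r * m)"
      by blast
  qed
  ultimately have "L = \<delta>" by simp
  thus ?thesis using limI[OF L] by (simp add: inducibility_def \<delta>_def)
qed

section \<open>The density in the balanced complete multipartite graphon\<close>

text \<open>
  The index of the part of the balanced graphon that contains \<open>y\<close>. The extra value \<open>r\<close> stands
  for the points outside the unit interval, and the minimum puts 1 into the last part.
\<close>

definition equal_part :: "nat \<Rightarrow> real \<Rightarrow> nat" where
  "equal_part r y = (if y \<in> {0..1} then min (r - 1) (nat \<lfloor>real r * y\<rfloor>) else r)"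

lemma graphon_part_equal:
  assumes "j < r"
  shows "graphon_part (replicate r (1 / real r)) j = {y. equal_part r y = j}"
proof -
  have sum: "sum_list (take i (replicate r (1 / real r))) = real i / real r" if "i \<le> r" for i
    using that by (simp add: sum_list_replicate min_def)
  have r: "0 < r" using assms by simp
  have part: "equal_part r y = j \<longleftrightarrow> y \<in> {0..1} \<and> min (r - 1) (nat \<lfloor>real r * y\<rfloor>) = j" for y
    using assms by (auto simp: equal_part_def)
  show ?thesis
  proof (cases "Suc j = r")
    case True
    have "graphon_part (replicate r (1 / real r)) j = {real j / real r..1}"
      using sum[of j] sum[of "Suc j"] True r by (simp add: graphon_part_def)
    also have "\<dots> = {y. equal_part r y = j}"
    proof (intro set_eqI iffI CollectI)
      fix y assume y: "y \<in> {real j / real r..1}"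
      hence "0 \<le> y" by (meson atLeastAtMost_iff divide_nonneg_nonneg of_nat_0_le_iff order_trans)
      moreover have "real j \<le> real r * y" using y r by (simp add: field_simps)
      hence "j \<le> nat \<lfloor>real r * y\<rfloor>" by (simp add: le_nat_floor)
      ultimately show "equal_part r y = j" unfolding part using y True by auto
    next
      fix y assume "y \<in> {y. equal_part r y = j}"
      hence y: "0 \<le> y" "y \<le> 1" "j \<le> nat \<lfloor>real r * y\<rfloor>" unfolding part mem_Collect_eq using True by auto
      hence "real j \<le> real r * y" using r by (simp add: le_nat_iff le_floor_iff)
      thus "y \<in> {real j / real r..1}" using y r by (simp add: field_simps)
    qed
    finally show ?thesis .
  next
    case False
    have "graphon_part (replicate r (1 / real r)) j = {real j / real r..<real (Suc j) / real r}"
      using sum[of j] sum[of "Suc j"] False assms by (simp add: graphon_part_def)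
    also have "\<dots> = {y. equal_part r y = j}"
    proof (intro set_eqI iffI CollectI)
      fix y assume y: "y \<in> {real j / real r..<real (Suc j) / real r}"
      hence "0 \<le> y" by (meson atLeastLessThan_iff divide_nonneg_nonneg of_nat_0_le_iff order_trans)
      moreover have "real (Suc j) / real r \<le> 1" using assms by simp
      hence "y \<le> 1" using y by (meson atLeastLessThan_iff less_imp_le order_trans)
      moreover have "\<lfloor>real r * y\<rfloor> = int j" using y r by (intro floor_unique) (auto simp: field_simps)
      ultimately show "equal_part r y = j" unfolding part using y False assms by auto
    next
      fix y assume "y \<in> {y. equal_part r y = j}"
      hence y: "0 \<le> y" "nat \<lfloor>real r * y\<rfloor> = j" unfolding part mem_Collect_eq using False assms by auto
      hence "\<lfloor>real r * y\<rfloor> = int j" using r by auto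
      hence "real j \<le> real r * y" "real r * y < real j + 1" by linarith+
      thus "y \<in> {real j / real r..<real (Suc j) / real r}" using r by (simp add: field_simps)
    qed
    finally show ?thesis .
  qed
qed

lemma equal_part_le: "0 < r \<Longrightarrow> equal_part r y \<le> r"
  by (auto simp: equal_part_def)

lemma multipartite_graphon_equal:
  "multipartite_graphon (replicate r (1 / real r)) x y = 1
    \<longleftrightarrow> \<not> (equal_part r x < r \<and> equal_part r x = equal_part r y)"
proof -
  have "z \<in> graphon_part (replicate r (1 / real r)) i \<longleftrightarrow> equal_part r z = i" if "i < r" for i z
    using graphon_part_equal[OF that] by simp
  hence "(\<exists>i<r. x \<in> graphon_part (replicate r (1 / real r)) i \<and>
        y \<in> graphon_part (replicate r (1 / real r)) i)
      \<longleftrightarrow> equal_part r x < r \<and> equal_part r x = equal_part r y"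
    by metis
  thus ?thesis by (simp add: multipartite_graphon_def)
qed

abbreviation unit_uniform :: "real measure" where
  "unit_uniform \<equiv> uniform_measure lborel {0..1}"

lemma equal_part_measurable: "{y. equal_part r y = j} \<in> sets unit_uniform"
proof -
  have "equal_part r \<in> measurable borel (count_space UNIV)"
    unfolding equal_part_def by measurable
  hence "equal_part r -` {j} \<inter> space borel \<in> sets borel" by (rule measurable_sets) simp
  moreover have "equal_part r -` {j} = {y. equal_part r y = j}" by auto
  ultimately show ?thesis by simp
qed

lemma measure_equal_part:
  assumes "j < r"
  shows "measure unit_uniform {y. equal_part r y = j} = 1 / real r"
proof -
  have r: "0 < r" using assms by simp
  have sum: "sum_list (take i (replicate r (1 / real r))) = real i / real r" if "i \<le> r" for i
    using that by (simp add: sum_list_replicate min_def)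
  let ?P = "graphon_part (replicate r (1 / real r)) j"
  have "{y. equal_part r y = j} \<subseteq> {0..1}" using assms by (auto simp: equal_part_def split: if_splits)
  hence "{0..1} \<inter> {y. equal_part r y = j} = ?P"
    using graphon_part_equal[OF assms] by auto
  moreover have "measure lborel ?P = real (Suc j) / real r - real j / real r"
    unfolding graphon_part_def length_replicate sum[OF less_imp_le[OF assms]] sum[OF Suc_leI[OF assms]]
    by (simp add: divide_right_mono)
  hence "measure lborel ?P = 1 / real r"
    by (simp flip: diff_divide_distrib)
  moreover have "{y. equal_part r y = j} \<in> sets lborel"
    using equal_part_measurable by simp
  ultimately show ?thesis by (subst measure_uniform_measure) auto
qed

lemma measure_equal_part_outside: "0 < r \<Longrightarrow> measure unit_uniform {y. equal_part r y = r} = 0"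
proof -
  assume "0 < r"
  hence "{0..1} \<inter> {y. equal_part r y = r} = {}" by (auto simp: equal_part_def)
  moreover have "{y. equal_part r y = r} \<in> sets lborel"
    using equal_part_measurable by simp
  ultimately show ?thesis by (subst measure_uniform_measure) auto
qed

text \<open>
  The sampled graph depends only on the parts that contain the sampled points, so the event is
  a finite disjoint union of boxes, one for each colouring that realizes \<open>F\<close>. Boxes with a side
  outside the unit interval are null, and every other box has measure \<open>(1 / r) ^ s\<close>.
\<close>

lemma graphon_density_equal_parts:
  assumes r: "0 < r" and s: "card (verts F) = s"
  shows "graphon_density F (multipartite_graphon (replicate r (1 / real r)))
    = real (card (good_colourings s r (realizes F))) / real r ^ s"
proof -
  let ?W = "multipartite_graphon (replicate r (1 / real r))"
  let ?M = "PiM {..<s} (\<lambda>_. unit_uniform)"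
  \<comment> \<open>Distinct indices with the colour \<open>r\<close> count as adjacent, since the graphon takes the value 1
    wherever a point lies outside the unit interval.\<close>
  define pat where "pat d = {(i, j). i < s \<and> j < s \<and> \<not> (d i < r \<and> d i = d j)}" for d :: "nat \<Rightarrow> nat"
  define D where "D = {d \<in> {..<s} \<rightarrow>\<^sub>E {..r}. realizes F (pat d)}"
  let ?B = "\<lambda>d. \<Pi>\<^sub>E i\<in>{..<s}. {y. equal_part r y = d i}"
  have "prob_space unit_uniform" by (rule prob_space_uniform_measure) auto
  then interpret P: finite_product_prob_space "\<lambda>_. unit_uniform" "{..<s}"
    by (intro finite_product_prob_space.intro product_prob_space.intro product_sigma_finite.intro
        product_prob_space_axioms.intro
        finite_product_sigma_finite.intro finite_product_sigma_finite_axioms.intro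
        prob_space_imp_sigma_finite) auto
  have space: "space ?M = {..<s} \<rightarrow>\<^sub>E UNIV" by (simp add: space_PiM)
  have iso: "graph_iso (sampled_graph ?W s x) F \<longleftrightarrow> realizes F (pat d)" if "x \<in> ?B d" for x d
  proof -
    have "equal_part r (x i) = d i" if "i < s" for i using \<open>x \<in> ?B d\<close> that by auto
    hence "(i < s \<and> j < s \<and> i \<noteq> j \<and> ?W (x i) (x j) = 1)
        = (i < s \<and> j < s \<and> i \<noteq> j \<and> (i, j) \<in> pat d)" for i j
      by (auto simp: multipartite_graphon_equal pat_def)
    hence "sampled_graph ?W s x = pattern_graph s (pat d)"
      by (simp only: sampled_graph_def pattern_graph_def)
    thus ?thesis by (simp add: realizes_def s)
  qed
  have set_eq: "{x \<in> space ?M. graph_iso (sampled_graph ?W s x) F} = (\<Union>d\<in>D. ?B d)"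
  proof (intro equalityI subsetI)
    fix x assume x: "x \<in> {x \<in> space ?M. graph_iso (sampled_graph ?W s x) F}"
    define d where "d = restrict (equal_part r \<circ> x) {..<s}"
    have xB: "x \<in> ?B d" using x by (auto simp: space d_def PiE_def Pi_def)
    moreover have "d \<in> {..<s} \<rightarrow>\<^sub>E {..r}" using equal_part_le[OF r] by (auto simp: d_def)
    ultimately show "x \<in> (\<Union>d\<in>D. ?B d)" using x iso[OF xB] by (auto simp: D_def)
  next
    fix x assume "x \<in> (\<Union>d\<in>D. ?B d)"
    then obtain d where d: "d \<in> D" "x \<in> ?B d" by blast
    moreover have "x \<in> space ?M" unfolding space using d(2) by (auto simp: PiE_def)
    ultimately show "x \<in> {x \<in> space ?M. graph_iso (sampled_graph ?W s x) F}"
      using iso[OF d(2)] by (simp add: D_def)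
  qed
  have finD: "finite D" unfolding D_def by (simp add: finite_PiE)
  have "measure ?M (\<Union>d\<in>D. ?B d) = (\<Sum>d\<in>D. measure ?M (?B d))"
  proof (rule P.finite_measure_finite_Union[OF finD])
    show "?B ` D \<subseteq> sets ?M"
      using equal_part_measurable by (auto intro!: sets_PiM_I_finite)
    have "d = d'" if "d \<in> D" "d' \<in> D" "x \<in> ?B d" "x \<in> ?B d'" for d d' x
    proof (rule PiE_ext[of _ "{..<s}" "\<lambda>_. {..r}"])
      show "d \<in> {..<s} \<rightarrow>\<^sub>E {..r}" "d' \<in> {..<s} \<rightarrow>\<^sub>E {..r}" using that by (simp_all add: D_def)
      fix i assume i: "i \<in> {..<s}"
      have "equal_part r (x i) = d i" "equal_part r (x i) = d' i" using that(3,4) i by auto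
      thus "d i = d' i" by simp
    qed
    thus "disjoint_family_on ?B D"
      unfolding disjoint_family_on_def by (metis (no_types, lifting) disjoint_iff)
  qed
  also have "\<dots> = (\<Sum>d\<in>D. \<Prod>i<s. measure unit_uniform {y. equal_part r y = d i})"
    by (intro sum.cong refl P.prob_times equal_part_measurable)
  also have "\<dots> = (\<Sum>d\<in>good_colourings s r (realizes F).
      \<Prod>i<s. measure unit_uniform {y. equal_part r y = d i})"
  proof (rule sum.mono_neutral_right[OF finD])
    have pat_eq: "pat d = adjacency_pattern s (\<noteq>) d" if "d \<in> {..<s} \<rightarrow>\<^sub>E {..<r}" for d
      using that by (auto simp: pat_def adjacency_pattern_def)
    have sub: "d \<in> {..<s} \<rightarrow>\<^sub>E {..r}" if "d \<in> {..<s} \<rightarrow>\<^sub>E {..<r}" for d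
      using that by (auto simp: PiE_def Pi_def less_imp_le)
    show "good_colourings s r (realizes F) \<subseteq> D"
      using pat_eq sub by (auto simp: good_colourings_def D_def)
    show "\<forall>d\<in>D - good_colourings s r (realizes F).
        (\<Prod>i<s. measure unit_uniform {y. equal_part r y = d i}) = 0"
    proof
      fix d assume d: "d \<in> D - good_colourings s r (realizes F)"
      have "d \<notin> {..<s} \<rightarrow>\<^sub>E {..<r}"
        using d pat_eq[of d] by (auto simp: good_colourings_def D_def)
      moreover have dr: "d \<in> {..<s} \<rightarrow>\<^sub>E {..r}" using d by (simp add: D_def)
      ultimately obtain i where i: "i < s" "\<not> d i < r" by (auto simp: PiE_iff)
      moreover have "d i \<le> r" using dr i(1) by auto
      ultimately have "i < s" "d i = r" by simp_all
      thus "(\<Prod>i<s. measure unit_uniform {y. equal_part r y = d i}) = 0"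
        using measure_equal_part_outside[OF r] by auto
    qed
  qed
  also have "\<dots> = (\<Sum>d\<in>good_colourings s r (realizes F). \<Prod>i<s. 1 / real r)"
  proof (intro sum.cong prod.cong refl)
    fix d i assume "d \<in> good_colourings s r (realizes F)" "i \<in> {..<s}"
    hence "d i < r" by (auto simp: good_colourings_def)
    thus "measure unit_uniform {y. equal_part r y = d i} = 1 / real r" by (rule measure_equal_part)
  qed
  also have "\<dots> = real (card (good_colourings s r (realizes F))) / real r ^ s"
    by (simp add: power_divide)
  finally show ?thesis
    unfolding graphon_density_def Let_def s set_eq .
qed

theorem proposition1p9:
  fixes r s :: nat and F :: "'a graph"
  assumes "2 \<le> r" and "r \<le> s"
    and "turan_graph s r F"
  shows "attained_by (r + 1) F (multipartite_graphon (replicate r (1 / real r)))"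
proof -
  obtain p where p: "turan_partition s r F p"
    using assms(3) by (auto simp: turan_graph_iff_partition)
  have "card (verts F) = s" using p by (simp add: turan_partition_def)
  thus ?thesis
    using graphon_density_equal_parts[of r F s] inducibility_turan_graph[OF p _ assms(2)] assms(1)
    by (simp add: attained_by_def)
qed

end
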